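(* Let $\Theta$ be an IBN variety of one-sorted algebras with signature $\Omega$, and let $H_1,H_2\in\Theta$. Then $H_1$ and $H_2$ are automorphically equivalent in $\Theta$ if and only if there exists a system of words $W=\{w_\omega(x)\in W(X_\omega)\mid\omega\in\Omega\}$ fulfilling conditions Op1) and Op2) such that $H_1$ is geometrically equivalent to the algebra $H_2^{*}$, where $H_2^{*}$ is the algebra which has the same domain as $H_2$ and whose operations $\omega^{*}_{H_2}$ ($\omega\in\Omega$) are the verbal operations induced on $H_2$ by the words $w_\omega(x)$.
   Context: Category $\Theta^0$. Let $X_0=\{x_1,x_2,\ldots,x_n,\ldots\}$ be a countable set of symbols. $\Theta^0$ is the category whose objects are the free algebras $W(X)$ of the variety $\Theta$ generated by the finite subsets $X\subset X_0$, and whose morphisms are all homomorphisms between these algebras. The variety $\Theta$ is called an IBN variety if two free algebras $W(X),W(Y)\in\Theta$ are isomorphic if and only if the cardinalities of $X$ and $Y$ coincide. Closed congruences. Let $H\in\Theta$, $B\in\mathrm{Ob}\,\Theta^0$. For $T\subset B^2$ put $T'_H=\{\mu\in\mathrm{Hom}(B,H)\mid T\subset\ker\mu\}$, and for $R\subset\mathrm{Hom}(B,H)$ put $R'_H=\bigcap_{\mu\in R}\ker\mu$. $T\subset B^2$ is called $H$-closed if $T=T''_H=(T'_H)'_H$; an $H$-closed set is a congruence on $B$. $Cl_H(B)$ denotes the set (lattice) of all $H$-closed congruences on $B$. Geometric equivalence. $H_1,H_2\in\Theta$ are geometrically equivalent if $Cl_{H_1}(B)=Cl_{H_2}(B)$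 for every $B\in\mathrm{Ob}\,\Theta^0$. Automorphic equivalence. $H_1,H_2\in\Theta$ are automorphically equivalent if there exist an automorphism $\Phi:\Theta^0\to\Theta^0$ and, for every $B\in\mathrm{Ob}\,\Theta^0$, a bijection $\alpha(\Phi)_B:Cl_{H_1}(B)\to Cl_{H_2}(\Phi(B))$ such that for all $B_1,B_2\in\mathrm{Ob}\,\Theta^0$, all $\mu_1,\mu_2\in\mathrm{Hom}(B_1,B_2)$ and all $T\in Cl_{H_1}(B_2)$: $\tau\mu_1=\tau\mu_2$ if and only if $\widetilde\tau\,\Phi(\mu_1)=\widetilde\tau\,\Phi(\mu_2)$, where $\tau:B_2\to B_2/T$ and $\widetilde\tau:\Phi(B_2)\to\Phi(B_2)/\alpha(\Phi)_{B_2}(T)$ are the natural epimorphisms. Verbal operations. For $\omega\in\Omega$ of arity $k$ put $X_\omega=\{x_1,\ldots,x_k\}\subset X_0$ and $A_\omega=W(X_\omega)$. A word $w(x)=w(x_1,\ldots,x_k)\in W(\{x_1,\ldots,x_k\})$ induces on every $H\in\Theta$ the $k$-ary verbal operation $w^{*}_H(h_1,\ldots,h_k)=\gamma_h(w)$, where $\gamma_h:W(\{x_1,\ldots,x_k\})\to H$ is the homomorphism with $\gamma_h(x_i)=h_i$, $1\le i\le k$. Given a system of words $W=\{w_\omega(x)\mid\omega\in\Omega\}$ with $w_\omega\in W(X_\omega)$, the verbal operation induced on $H$ by $w_\omega$ is denoted $\omega^{*}_H$, and $H^{*}$ denotes the algebra of signature $\Omega$ with the same domain as $H$, in which each $\omega\in\Omega$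 is realized by $\omega^{*}_H$. Conditions on a system of words $W=\{w_\omega(x)\mid\omega\in\Omega\}$: Op1) for every $\omega\in\Omega$, $w_\omega\in W(X_\omega)$ with $X_\omega=\{x_1,\ldots,x_k\}$, where $k$ is the arity of $\omega$; Op2) for every $B=W(X)\in\mathrm{Ob}\,\Theta^0$ there exists an isomorphism $\sigma_B:B\to B^{*}$ such that $\sigma_B|_X=\mathrm{id}_X$. (It is a fact that $H^{*}\in\Theta$ for every $H\in\Theta$ when $W$ fulfills Op1) and Op2), so geometric equivalence of $H_1$ and $H_2^{*}$ makes sense.) *)

theory Defs
  imports Main "HOL-Library.FuncSet"
begin

section \<open>Varieties of one-sorted algebras\<close>

text \<open>
  The countable set of symbols \<open>x\<^sub>1, x\<^sub>2, \<dots>\<close> is the type \<^typ>\<open>nat\<close>, with \<open>x\<^sub>i\<close> encoded as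
  \<open>i - 1\<close>; thus \<open>{x\<^sub>1, \<dots>, x\<^sub>k}\<close> is \<open>{..<k}\<close>.
\<close>

datatype 'f trm = Var nat | Fn 'f "'f trm list"

text \<open>
  The operation symbols form a set rather than a whole type, so that the empty signature is
  included. A variety is presented by its defining identities.
\<close>

record 'f variety =
  symbols :: "'f set"
  arity :: "'f \<Rightarrow> nat"
  identities :: "('f trm \<times> 'f trm) set"

record ('f, 'a) algebra =
  carrier :: "'a set"
  interp :: "'f \<Rightarrow> 'a list \<Rightarrow> 'a"

inductive_set terms :: "'f variety \<Rightarrow> nat set \<Rightarrow> 'f trm set" for V X where
  Var: "x \<in> X \<Longrightarrow> Var x \<in> terms V X"
| Fn: "f \<in> symbols V \<Longrightarrow> length ts = arity V f \<Longrightarrow> \<forall>t\<in>set ts. t \<in> terms V X \<Longrightarrow> Fn f ts \<in> terms V X"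

definition is_variety :: "'f variety \<Rightarrow> bool" where
  "is_variety V \<longleftrightarrow> identities V \<subseteq> terms V UNIV \<times> terms V UNIV"

fun eval :: "('f, 'a) algebra \<Rightarrow> (nat \<Rightarrow> 'a) \<Rightarrow> 'f trm \<Rightarrow> 'a" where
  "eval H a (Var x) = a x"
| "eval H a (Fn f ts) = interp H f (map (eval H a) ts)"

text \<open>
  Carriers may be empty. The free algebra on the empty set is empty when there are no constants.
\<close>

definition is_algebra :: "'f variety \<Rightarrow> ('f, 'a) algebra \<Rightarrow> bool" where
  "is_algebra V H \<longleftrightarrow>
    (\<forall>f\<in>symbols V. \<forall>hs. length hs = arity V f \<and> set hs \<subseteq> carrier H \<longrightarrow> interp H f hs \<in> carrier H)"

definition in_variety :: "'f variety \<Rightarrow> ('f, 'a) algebra \<Rightarrow> bool" where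
  "in_variety V H \<longleftrightarrow> is_algebra V H \<and>
    (\<forall>(s, t)\<in>identities V. \<forall>a. range a \<subseteq> carrier H \<longrightarrow> eval H a s = eval H a t)"

text \<open>
  Homomorphisms are extensional on the carrier of the domain, so that equality of functions is
  equality of morphisms.
\<close>

definition Hom :: "'f variety \<Rightarrow> ('f, 'a) algebra \<Rightarrow> ('f, 'b) algebra \<Rightarrow> ('a \<Rightarrow> 'b) set" where
  "Hom V A B = {\<mu> \<in> carrier A \<rightarrow>\<^sub>E carrier B.
    \<forall>f\<in>symbols V. \<forall>as. length as = arity V f \<and> set as \<subseteq> carrier A \<longrightarrow>
      \<mu> (interp A f as) = interp B f (map \<mu> as)}"

definition Iso :: "'f variety \<Rightarrow> ('f, 'a) algebra \<Rightarrow> ('f, 'b) algebra \<Rightarrow> ('a \<Rightarrow> 'b) set" where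
  "Iso V A B = {\<mu> \<in> Hom V A B. bij_betw \<mu> (carrier A) (carrier B)}"

section \<open>Free algebras\<close>

abbreviation term_algebra :: "'f variety \<Rightarrow> nat set \<Rightarrow> ('f, 'f trm) algebra" where
  "term_algebra V X \<equiv> \<lparr>carrier = terms V X, interp = Fn\<rparr>"

text \<open>
  The least congruence on the algebra of terms over \<open>X\<close> that contains all instances over \<open>X\<close> of
  the identities of the variety.
\<close>

inductive term_cong :: "'f variety \<Rightarrow> nat set \<Rightarrow> 'f trm \<Rightarrow> 'f trm \<Rightarrow> bool" for V X where
  inst: "(s, t) \<in> identities V \<Longrightarrow> range a \<subseteq> terms V X \<Longrightarrow>
    term_cong V X (eval (term_algebra V X) a s) (eval (term_algebra V X) a t)"
| refl: "t \<in> terms V X \<Longrightarrow> term_cong V X t t"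
| sym: "term_cong V X s t \<Longrightarrow> term_cong V X t s"
| trans: "term_cong V X s t \<Longrightarrow> term_cong V X t u \<Longrightarrow> term_cong V X s u"
| cong: "f \<in> symbols V \<Longrightarrow> length ss = arity V f \<Longrightarrow> list_all2 (term_cong V X) ss ts \<Longrightarrow>
    term_cong V X (Fn f ss) (Fn f ts)"

definition term_class :: "'f variety \<Rightarrow> nat set \<Rightarrow> 'f trm \<Rightarrow> 'f trm set" where
  "term_class V X t = {s. term_cong V X t s}"

text \<open>
  The operations are read off from arbitrarily chosen representatives; the choice is immaterial
  because \<^const>\<open>term_cong\<close> is a congruence.
\<close>

definition free_alg :: "'f variety \<Rightarrow> nat set \<Rightarrow> ('f, 'f trm set) algebra" where
  "free_alg V X = \<lparr>
    carrier = term_class V X ` terms V X,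
    interp = (\<lambda>f cs. term_class V X (Fn f (map (\<lambda>c. SOME t. t \<in> c) cs)))\<rparr>"

abbreviation gen :: "'f variety \<Rightarrow> nat set \<Rightarrow> nat \<Rightarrow> 'f trm set" where
  "gen V X x \<equiv> term_class V X (Var x)"

text \<open>
  Next, \<^term>\<open>free_alg V X\<close> is shown to lie in the variety, to have the universal property of the free
  algebra, and to determine \<open>X\<close>.
\<close>

lemma eval_in_carrier:
  assumes "t \<in> terms V X" "is_algebra V H" "\<forall>x\<in>X. a x \<in> carrier H" shows "eval H a t \<in> carrier H"
  using assms(1)
proof induction
  case (Var x) then show ?case using assms by simp
next
  case (Fn f ts) then show ?case using assms(2) by (auto simp: is_algebra_def image_subset_iff)
qed

lemma is_algebra_term_algebra: "is_algebra V (term_algebra V X)"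
  by (auto simp: is_algebra_def intro!: terms.Fn)

lemma term_cong_terms: assumes "is_variety V" "term_cong V X s t" shows "s \<in> terms V X \<and> t \<in> terms V X"
  using assms(2)
proof induction
  case (inst s t a)
  then have "s \<in> terms V UNIV" "t \<in> terms V UNIV" using assms(1) by (auto simp: is_variety_def)
  then show ?case using inst(2) eval_in_carrier[OF _ is_algebra_term_algebra, of _ V UNIV a X] by (auto simp: image_subset_iff)
next
  case (cong f ss ts)
  then show ?case by (auto intro!: terms.Fn simp: list_all2_conv_all_nth in_set_conv_nth)
qed auto

lemma term_class_eq_iff: assumes "is_variety V" "s \<in> terms V X" "t \<in> terms V X"
  shows "term_class V X s = term_class V X t \<longleftrightarrow> term_cong V X s t"
  using assms(2,3) unfolding term_class_def
  by (auto intro: term_cong.refl term_cong.sym term_cong.trans)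

lemma term_cong_representative: assumes "is_variety V" "t \<in> terms V X"
  shows "term_cong V X t (SOME s. s \<in> term_class V X t)"
  using someI[of "\<lambda>s. s \<in> term_class V X t" t] assms by (auto simp: term_class_def intro: term_cong.refl)

lemma interp_free_alg:
  assumes "is_variety V" "f \<in> symbols V" "length ts = arity V f" "set ts \<subseteq> terms V X"
  shows "interp (free_alg V X) f (map (term_class V X) ts) = term_class V X (Fn f ts)"
proof -
  have "term_cong V X (Fn f ts) (Fn f (map (\<lambda>t. SOME s. s \<in> term_class V X t) ts))"
    using assms term_cong_representative[OF assms(1)] by (intro term_cong.cong) (auto simp: list_all2_conv_all_nth subset_iff)
  moreover have "Fn f ts \<in> terms V X" using assms by (auto intro!: terms.Fn)
  ultimately show ?thesis
    using term_class_eq_iff[OF assms(1)] term_cong_terms[OF assms(1)] by (simp add: free_alg_def comp_def) metis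
qed

lemma is_algebra_free_alg: assumes "is_variety V" shows "is_algebra V (free_alg V X)"
  unfolding is_algebra_def
proof (intro ballI allI impI, elim conjE)
  fix f cs assume f: "f \<in> symbols V" "length cs = arity V f" "set cs \<subseteq> carrier (free_alg V X)"
  then have "\<forall>c\<in>set cs. \<exists>t. t \<in> terms V X \<and> c = term_class V X t" by (auto simp: free_alg_def)
  then obtain g where g: "\<forall>c\<in>set cs. g c \<in> terms V X \<and> c = term_class V X (g c)" by metis
  have cs: "cs = map (term_class V X) (map g cs)" using g by (simp add: map_idI)
  have "Fn f (map g cs) \<in> terms V X" using f g by (auto intro!: terms.Fn)
  moreover have "interp (free_alg V X) f cs = term_class V X (Fn f (map g cs))"
    by (subst cs, rule interp_free_alg) (use assms f g in auto)
  ultimately show "interp (free_alg V X) f cs \<in> carrier (free_alg V X)" by (auto simp: free_alg_def)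
qed

lemma eval_free_alg: assumes "is_variety V" "t \<in> terms V Y" "\<forall>y\<in>Y. b y \<in> terms V X"
  shows "eval (free_alg V X) (\<lambda>y::nat. term_class V X (b y)) t = term_class V X (eval (term_algebra V X) b t)"
  using assms(2)
proof induction
  case (Var x) then show ?case by simp
next
  case (Fn f ts)
  have "map (eval (free_alg V X) (\<lambda>y. term_class V X (b y))) ts = map (term_class V X) (map (eval (term_algebra V X) b) ts)"
    using Fn by simp
  moreover have "set (map (eval (term_algebra V X) b) ts) \<subseteq> terms V X"
    using Fn eval_in_carrier[OF _ is_algebra_term_algebra, of _ V Y b X] assms(3) by auto
  ultimately show ?case using interp_free_alg[OF assms(1) Fn(1), of "map (eval (term_algebra V X) b) ts" X] Fn(2)
    by (metis eval.simps(2) length_map simps(2) algebra.select_convs(2))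
qed

theorem in_variety_free_alg: assumes "is_variety V" shows "in_variety V (free_alg V X)"
  unfolding in_variety_def
proof (intro conjI is_algebra_free_alg[OF assms] ballI, clarify)
  fix s t and a :: "nat \<Rightarrow> _" assume st: "(s, t) \<in> identities V" and a: "range a \<subseteq> carrier (free_alg V X)"
  have "\<forall>y. \<exists>u. u \<in> terms V X \<and> a y = term_class V X u" using a by (auto simp: free_alg_def)
  then obtain b where b: "\<forall>y. b y \<in> terms V X \<and> a y = term_class V X (b y)" by metis
  then have ab: "a = (\<lambda>y. term_class V X (b y))" by auto
  have T: "s \<in> terms V UNIV" "t \<in> terms V UNIV" using st assms by (auto simp: is_variety_def)
  have "term_cong V X (eval (term_algebra V X) b s) (eval (term_algebra V X) b t)"
    using st b by (intro term_cong.inst) auto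
  then show "eval (free_alg V X) a s = eval (free_alg V X) a t"
    using T b term_class_eq_iff[OF assms] term_cong_terms[OF assms] eval_free_alg[OF assms, of _ UNIV b X] ab by metis
qed

lemma eval_eval_term_algebra:
  assumes "s \<in> terms V UNIV"
  shows "eval H a (eval (term_algebra V X) b s) = eval H (\<lambda>y. eval H a (b y)) s"
  using assms
proof induction
  case (Fn f ts) then show ?case by (simp cong: map_cong)
qed simp

lemma term_cong_sound: assumes V: "is_variety V" and H: "in_variety V H" and a: "\<forall>x\<in>X. a x \<in> carrier H" and st: "term_cong V X s t"
  shows "eval H a s = eval H a t"
  using st
proof induction
  case (inst s t b)
  have T: "s \<in> terms V UNIV" "t \<in> terms V UNIV" using inst V by (auto simp: is_variety_def)
  have "range (\<lambda>y. eval H a (b y)) \<subseteq> carrier H"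
    using inst(2) H a by (auto simp: in_variety_def intro!: eval_in_carrier)
  then show ?case using H inst(1) T by (auto simp: in_variety_def eval_eval_term_algebra)
next
  case (cong f ss ts)
  then have "map (eval H a) ss = map (eval H a) ts" by (auto simp: list_all2_conv_all_nth intro: nth_equalityI)
  then show ?case by simp
qed auto

theorem free_alg_universal: assumes V: "is_variety V" and H: "in_variety V H" and a: "a \<in> X \<rightarrow> carrier H"
  shows "\<exists>!\<mu>. \<mu> \<in> Hom V (free_alg V X) H \<and> (\<forall>x\<in>X. \<mu> (gen V X x) = a x)"
proof (rule ex_ex1I)
  have a': "\<forall>x\<in>X. a x \<in> carrier H" using a by auto
  define \<mu> where "\<mu> = (\<lambda>c\<in>carrier (free_alg V X). eval H a (SOME s. s \<in> c))"
  have m: "\<mu> (term_class V X t) = eval H a t" if "t \<in> terms V X" for t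
    using that term_cong_sound[OF V H a' term_cong_representative[OF V that]] by (auto simp: \<mu>_def free_alg_def)
  have "\<mu> \<in> Hom V (free_alg V X) H"
    unfolding Hom_def
  proof (intro CollectI conjI ballI allI impI, goal_cases)
    case 1
    have "\<mu> c \<in> carrier H" if "c \<in> carrier (free_alg V X)" for c
      using that m eval_in_carrier[of _ V X H a] a' H by (auto simp: free_alg_def in_variety_def)
    then show ?case by (auto simp: \<mu>_def)
  next
    case (2 f cs)
    then have f: "f \<in> symbols V" "length cs = arity V f" "set cs \<subseteq> carrier (free_alg V X)" by auto
    then have "\<forall>c\<in>set cs. \<exists>t. t \<in> terms V X \<and> c = term_class V X t" by (auto simp: free_alg_def)
    then obtain g where g: "\<forall>c\<in>set cs. g c \<in> terms V X \<and> c = term_class V X (g c)" by metis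
    have cs: "cs = map (term_class V X) (map g cs)" using g by (simp add: map_idI)
    have F: "Fn f (map g cs) \<in> terms V X" using f g by (auto intro!: terms.Fn)
    have "interp (free_alg V X) f cs = term_class V X (Fn f (map g cs))"
      by (subst cs, rule interp_free_alg) (use V f g in auto)
    moreover have "map \<mu> cs = map (eval H a) (map g cs)"
      using g m by (auto simp: comp_def) metis
    ultimately show ?case using m[OF F] by (metis eval.simps(2))
  qed
  moreover have "\<forall>x\<in>X. \<mu> (gen V X x) = a x" by (simp add: m terms.Var)
  ultimately show "\<exists>\<mu>. \<mu> \<in> Hom V (free_alg V X) H \<and> (\<forall>x\<in>X. \<mu> (gen V X x) = a x)" by blast
next
  fix \<mu> \<nu> assume A: "\<mu> \<in> Hom V (free_alg V X) H \<and> (\<forall>x\<in>X. \<mu> (gen V X x) = a x)"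
    and B: "\<nu> \<in> Hom V (free_alg V X) H \<and> (\<forall>x\<in>X. \<nu> (gen V X x) = a x)"
  have eq: "\<mu> (term_class V X t) = \<nu> (term_class V X t)" if "t \<in> terms V X" for t
    using that
  proof induction
    case (Fn f ts)
    have "\<rho> (term_class V X (Fn f ts)) = interp H f (map \<rho> (map (term_class V X) ts))"
      if "\<rho> \<in> Hom V (free_alg V X) H" for \<rho>
    proof -
      have "set (map (term_class V X) ts) \<subseteq> carrier (free_alg V X)" using Fn(3) by (auto simp: free_alg_def)
      then have "\<rho> (interp (free_alg V X) f (map (term_class V X) ts)) = interp H f (map \<rho> (map (term_class V X) ts))"
        using that Fn(1,2) unfolding Hom_def by auto
      then show ?thesis using interp_free_alg[OF V Fn(1,2), of X] Fn(3) by (simp add: subset_iff)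
    qed
    moreover have "map \<mu> (map (term_class V X) ts) = map \<nu> (map (term_class V X) ts)" using Fn by simp
    ultimately show ?case using A B by metis
  qed (use A B in auto)
  show "\<mu> = \<nu>"
    using A B eq by (intro extensionalityI[of _ "carrier (free_alg V X)"]) (auto simp: Hom_def PiE_def free_alg_def)
qed

lemma free_alg_inject: assumes V: "is_variety V" and "free_alg V X = free_alg V Y" shows "X = Y"
proof -
  have *: "\<Union> (carrier (free_alg V Z)) = terms V Z" for Z
    using term_cong_terms[OF V] by (auto simp: free_alg_def term_class_def intro: term_cong.refl)
  have "Z = {x. Var x \<in> terms V Z}" for Z by (auto intro: terms.Var elim: terms.cases)
  then show ?thesis using * assms(2) by metis
qed

definition IBN_variety :: "'f variety \<Rightarrow> bool" where
  "IBN_variety V \<longleftrightarrow> is_variety V \<and>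
    (\<forall>X Y. finite X \<and> finite Y \<longrightarrow>
      (Iso V (free_alg V X) (free_alg V Y) \<noteq> {} \<longleftrightarrow> card X = card Y))"

section \<open>The category of finitely generated free algebras\<close>

text \<open>
  The morphisms from \<open>A\<close> to \<open>B\<close> are \<^term>\<open>Hom V A B\<close>, with identity
  \<^term>\<open>restrict id (carrier A)\<close> and composition \<^term>\<open>compose (carrier A)\<close>.
\<close>

definition free_obs :: "'f variety \<Rightarrow> ('f, 'f trm set) algebra set" where
  "free_obs V = {free_alg V X |X. finite X}"

type_synonym 'f ob_map = "('f, 'f trm set) algebra \<Rightarrow> ('f, 'f trm set) algebra"
type_synonym 'f mor_map = "('f, 'f trm set) algebra \<Rightarrow> ('f, 'f trm set) algebra \<Rightarrow>
  ('f trm set \<Rightarrow> 'f trm set) \<Rightarrow> ('f trm set \<Rightarrow> 'f trm set)"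

definition category_automorphism :: "'f variety \<Rightarrow> 'f ob_map \<Rightarrow> 'f mor_map \<Rightarrow> bool" where
  "category_automorphism V \<Phi>\<^sub>o \<Phi>\<^sub>m \<longleftrightarrow>
    bij_betw \<Phi>\<^sub>o (free_obs V) (free_obs V) \<and>
    (\<forall>A\<in>free_obs V. \<forall>B\<in>free_obs V.
      bij_betw (\<Phi>\<^sub>m A B) (Hom V A B) (Hom V (\<Phi>\<^sub>o A) (\<Phi>\<^sub>o B))) \<and>
    (\<forall>A\<in>free_obs V. \<Phi>\<^sub>m A A (restrict id (carrier A)) = restrict id (carrier (\<Phi>\<^sub>o A))) \<and>
    (\<forall>A\<in>free_obs V. \<forall>B\<in>free_obs V. \<forall>C\<in>free_obs V. \<forall>\<mu>\<in>Hom V A B. \<forall>\<nu>\<in>Hom V B C.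
      \<Phi>\<^sub>m A C (compose (carrier A) \<nu> \<mu>) = compose (carrier (\<Phi>\<^sub>o A)) (\<Phi>\<^sub>m B C \<nu>) (\<Phi>\<^sub>m A B \<mu>))"

section \<open>Closed congruences and equivalence of algebras\<close>

definition ker :: "('f, 'b) algebra \<Rightarrow> ('b \<Rightarrow> 'a) \<Rightarrow> ('b \<times> 'b) set" where
  "ker B \<mu> = {(a, b) \<in> carrier B \<times> carrier B. \<mu> a = \<mu> b}"

definition solutions ::
  "'f variety \<Rightarrow> ('f, 'a) algebra \<Rightarrow> ('f, 'b) algebra \<Rightarrow> ('b \<times> 'b) set \<Rightarrow> ('b \<Rightarrow> 'a) set" where
  "solutions V H B T = {\<mu> \<in> Hom V B H. T \<subseteq> ker B \<mu>}"

text \<open>The intersection is taken inside \<open>B\<^sup>2\<close>: for empty \<open>R\<close> it is \<open>B\<^sup>2\<close>.\<close>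

definition common_ker :: "('f, 'b) algebra \<Rightarrow> ('b \<Rightarrow> 'a) set \<Rightarrow> ('b \<times> 'b) set" where
  "common_ker B R = (carrier B \<times> carrier B) \<inter> (\<Inter>\<mu>\<in>R. ker B \<mu>)"

definition Cl :: "'f variety \<Rightarrow> ('f, 'a) algebra \<Rightarrow> ('f, 'b) algebra \<Rightarrow> ('b \<times> 'b) set set" where
  "Cl V H B = {T. T \<subseteq> carrier B \<times> carrier B \<and> T = common_ker B (solutions V H B T)}"

definition geometrically_equivalent ::
  "'f variety \<Rightarrow> ('f, 'a) algebra \<Rightarrow> ('f, 'b) algebra \<Rightarrow> bool" where
  "geometrically_equivalent V H\<^sub>1 H\<^sub>2 \<longleftrightarrow> (\<forall>B\<in>free_obs V. Cl V H\<^sub>1 B = Cl V H\<^sub>2 B)"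

definition nat_epi :: "('f, 'b) algebra \<Rightarrow> ('b \<times> 'b) set \<Rightarrow> 'b \<Rightarrow> 'b set" where
  "nat_epi B T = (\<lambda>b\<in>carrier B. T `` {b})"

definition automorphically_equivalent ::
  "'f variety \<Rightarrow> ('f, 'a) algebra \<Rightarrow> ('f, 'b) algebra \<Rightarrow> bool" where
  "automorphically_equivalent V H\<^sub>1 H\<^sub>2 \<longleftrightarrow>
    (\<exists>\<Phi>\<^sub>o \<Phi>\<^sub>m \<alpha>. category_automorphism V \<Phi>\<^sub>o \<Phi>\<^sub>m \<and>
      (\<forall>B\<in>free_obs V. bij_betw (\<alpha> B) (Cl V H\<^sub>1 B) (Cl V H\<^sub>2 (\<Phi>\<^sub>o B))) \<and>
      (\<forall>B\<^sub>1\<in>free_obs V. \<forall>B\<^sub>2\<in>free_obs V.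
        \<forall>\<mu>\<^sub>1\<in>Hom V B\<^sub>1 B\<^sub>2. \<forall>\<mu>\<^sub>2\<in>Hom V B\<^sub>1 B\<^sub>2. \<forall>T\<in>Cl V H\<^sub>1 B\<^sub>2.
          compose (carrier B\<^sub>1) (nat_epi B\<^sub>2 T) \<mu>\<^sub>1 = compose (carrier B\<^sub>1) (nat_epi B\<^sub>2 T) \<mu>\<^sub>2 \<longleftrightarrow>
          compose (carrier (\<Phi>\<^sub>o B\<^sub>1)) (nat_epi (\<Phi>\<^sub>o B\<^sub>2) (\<alpha> B\<^sub>2 T)) (\<Phi>\<^sub>m B\<^sub>1 B\<^sub>2 \<mu>\<^sub>1) =
          compose (carrier (\<Phi>\<^sub>o B\<^sub>1)) (nat_epi (\<Phi>\<^sub>o B\<^sub>2) (\<alpha> B\<^sub>2 T)) (\<Phi>\<^sub>m B\<^sub>1 B\<^sub>2 \<mu>\<^sub>2)))"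

section \<open>Verbal operations\<close>

definition verbal_op ::
  "'f variety \<Rightarrow> ('f, 'a) algebra \<Rightarrow> nat \<Rightarrow> 'f trm set \<Rightarrow> 'a list \<Rightarrow> 'a" where
  "verbal_op V H k w hs =
    (THE \<gamma>. \<gamma> \<in> Hom V (free_alg V {..<k}) H \<and> (\<forall>i<k. \<gamma> (gen V {..<k} i) = hs ! i)) w"

definition star :: "'f variety \<Rightarrow> ('f \<Rightarrow> 'f trm set) \<Rightarrow> ('f, 'a) algebra \<Rightarrow> ('f, 'a) algebra" where
  "star V w H = \<lparr>carrier = carrier H, interp = (\<lambda>f. verbal_op V H (arity V f) (w f))\<rparr>"

definition Op1 :: "'f variety \<Rightarrow> ('f \<Rightarrow> 'f trm set) \<Rightarrow> bool" where
  "Op1 V w \<longleftrightarrow> (\<forall>f\<in>symbols V. w f \<in> carrier (free_alg V {..<arity V f}))"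

definition Op2 :: "'f variety \<Rightarrow> ('f \<Rightarrow> 'f trm set) \<Rightarrow> bool" where
  "Op2 V w \<longleftrightarrow> (\<forall>X. finite X \<longrightarrow>
    (\<exists>\<sigma>\<in>Iso V (free_alg V X) (star V w (free_alg V X)). \<forall>x\<in>X. \<sigma> (gen V X x) = gen V X x))"

end

theory Submission
  imports Defs
begin

text \<open>
  Both sides of the equivalence amount to the same data: for each object \<open>A\<close> of the category a bijection
  \<open>S A\<close> from the elements of \<open>A\<close> to those of an object \<open>\<Phi> A\<close>, such that \<open>\<mu> \<mapsto> S B \<circ> \<mu> \<circ> (S A)\<inverse>\<close> takes
  homomorphisms to homomorphisms, and such that \<open>S A \<times> S A\<close> carries the relations closed for
  \<open>H\<^sub>1\<close> to those closed for \<open>H\<^sub>2\<close>.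

  From an automorphism \<open>\<Phi>\<close> such bijections are obtained as follows. An element \<open>a\<close> of \<open>A\<close> is a morphism to \<open>A\<close>
  from the free algebra on one generator, so \<open>\<Phi>\<close> acts on elements as soon as the image of that algebra
  is again free on one generator. It is (\<open>monogenic_image\<close>), because \<open>\<Phi>\<close> preserves coproducts and
  hence multiplies ranks by the rank of this image; being surjective on objects it also attains rank one,
  and invariance of rank makes the factor one. The bijections \<open>S\<close> need not be homomorphisms. They do send the
  generators of \<open>A = F X\<close> to a free basis of \<open>\<Phi> A\<close>, so there is an isomorphism \<open>s\<close> with the same effect on
  generators, and \<open>\<sigma> = s\<inverse> \<circ> S\<close> is a permutation of \<open>F X\<close> that fixes the generators and whose conjugation takes
  homomorphisms to homomorphisms (\<open>\<sigma>_natural\<close>). The latter, applied to the homomorphism that sends the generators of \<open>F {..<k}\<close> to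
  given elements, says that \<open>\<sigma>\<close> is an isomorphism onto the algebra whose operations are given by the words
  \<open>\<sigma> (f (x\<^sub>1, \<dots>, x\<^sub>k))\<close> (\<open>\<sigma>_Iso_star\<close>). Conversely, given words with isomorphisms \<open>\<sigma>\<close>, take
  \<open>\<Phi>\<close> to be the identity on objects and \<open>S = \<sigma>\<close>.

  The passage between closed relations rests on one observation (\<open>Hom_to_star\<close>, \<open>Cl_transport\<close>): the
  homomorphisms from \<open>F X\<close> to the derived algebra of \<open>H\<close> are the maps \<open>\<nu> \<circ> \<sigma>\<close> with \<open>\<nu>\<close> a homomorphism
  from \<open>F X\<close> to \<open>H\<close>, so \<open>T\<close> is closed for the derived algebra if and only if its image under \<open>\<sigma> \<times> \<sigma>\<close> is closed
  for \<open>H\<close>. On the other side, the compatibility condition in automorphic equivalence, applied to morphisms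
  that name elements, forces the bijection between the lattices of closed congruences to be \<open>S \<times> S\<close>.
\<close>

section \<open>Homomorphisms out of free algebras\<close>

lemma Hom_closed: "\<mu> \<in> Hom V A B \<Longrightarrow> a \<in> carrier A \<Longrightarrow> \<mu> a \<in> carrier B"
  by (auto simp: Hom_def)

lemma Hom_interp:
  "\<mu> \<in> Hom V A B \<Longrightarrow> f \<in> symbols V \<Longrightarrow> length as = arity V f \<Longrightarrow> set as \<subseteq> carrier A \<Longrightarrow>
    \<mu> (interp A f as) = interp B f (map \<mu> as)"
  by (auto simp: Hom_def)

lemma Hom_extensional: "\<mu> \<in> Hom V A B \<Longrightarrow> \<mu> \<in> extensional (carrier A)"
  by (auto simp: Hom_def PiE_def)

lemma Hom_compose:
  assumes "is_algebra V A" "\<mu> \<in> Hom V A B" "\<nu> \<in> Hom V B C"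
  shows "compose (carrier A) \<nu> \<mu> \<in> Hom V A C"
  unfolding Hom_def
proof (intro CollectI conjI ballI allI impI)
  show "compose (carrier A) \<nu> \<mu> \<in> carrier A \<rightarrow>\<^sub>E carrier C"
    using Hom_closed[OF assms(2)] Hom_closed[OF assms(3)] by (auto simp: compose_def)
next
  fix f as assume f: "f \<in> symbols V" and as: "length as = arity V f \<and> set as \<subseteq> carrier A"
  have "interp A f as \<in> carrier A" using assms(1) f as by (auto simp: is_algebra_def)
  moreover have "set (map \<mu> as) \<subseteq> carrier B" using as Hom_closed[OF assms(2)] by auto
  moreover have "map (compose (carrier A) \<nu> \<mu>) as = map \<nu> (map \<mu> as)"
    using as by (auto simp: compose_def subset_iff)
  ultimately show "compose (carrier A) \<nu> \<mu> (interp A f as) = interp C f (map (compose (carrier A) \<nu> \<mu>) as)"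
    using Hom_interp[OF assms(2) f, of as] Hom_interp[OF assms(3) f, of "map \<mu> as"] as
    by (simp only: compose_eq length_map)
qed

lemma Hom_id: "is_algebra V A \<Longrightarrow> restrict id (carrier A) \<in> Hom V A A"
  by (auto simp: Hom_def is_algebra_def subset_iff map_idI)

lemma Iso_inverse:
  assumes "is_algebra V A" "\<mu> \<in> Iso V A B"
  shows "restrict (inv_into (carrier A) \<mu>) (carrier B) \<in> Hom V B A"
proof -
  define \<nu> where "\<nu> = restrict (inv_into (carrier A) \<mu>) (carrier B)"
  have \<mu>: "\<mu> \<in> Hom V A B" "bij_betw \<mu> (carrier A) (carrier B)" using assms(2) by (auto simp: Iso_def)
  have \<nu>: "\<nu> b \<in> carrier A" "\<mu> (\<nu> b) = b" if "b \<in> carrier B" for b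
    using that \<mu>(2) by (auto simp: \<nu>_def bij_betw_def intro: inv_into_into f_inv_into_f)
  have \<nu>\<mu>: "\<nu> (\<mu> a) = a" if "a \<in> carrier A" for a
    using that \<mu> Hom_closed[OF \<mu>(1)] by (auto simp: \<nu>_def bij_betw_def)
  have "\<nu> \<in> Hom V B A"
    unfolding Hom_def
  proof (intro CollectI conjI ballI allI impI)
    show "\<nu> \<in> carrier B \<rightarrow>\<^sub>E carrier A" using \<nu> by (auto simp: \<nu>_def)
  next
    fix f bs assume f: "f \<in> symbols V" and bs: "length bs = arity V f \<and> set bs \<subseteq> carrier B"
    have as: "set (map \<nu> bs) \<subseteq> carrier A" using bs \<nu> by auto
    have "map \<mu> (map \<nu> bs) = bs" using bs \<nu>(2) by (auto simp: comp_def subset_iff intro!: map_idI)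
    then have "interp B f bs = \<mu> (interp A f (map \<nu> bs))"
      using Hom_interp[OF \<mu>(1) f _ as] bs by simp
    moreover have "interp A f (map \<nu> bs) \<in> carrier A" using assms(1) f bs as by (auto simp: is_algebra_def)
    ultimately show "\<nu> (interp B f bs) = interp A f (map \<nu> bs)" using \<nu>\<mu> by simp
  qed
  then show ?thesis by (simp add: \<nu>_def)
qed

text \<open>
  The description is definite when \<open>H\<close> lies in the variety and \<open>a\<close> maps \<open>X\<close> into it, by freeness.
\<close>

definition lift :: "'f variety \<Rightarrow> nat set \<Rightarrow> ('f, 'a) algebra \<Rightarrow> (nat \<Rightarrow> 'a) \<Rightarrow> 'f trm set \<Rightarrow> 'a" where
  "lift V X H a = (THE \<mu>. \<mu> \<in> Hom V (free_alg V X) H \<and> (\<forall>x\<in>X. \<mu> (gen V X x) = a x))"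

locale equational_class =
  fixes V :: "'f variety"
  assumes V: "is_variety V"
begin

abbreviation F :: "nat set \<Rightarrow> ('f, 'f trm set) algebra" where
  "F \<equiv> free_alg V"

lemma gen_in_carrier: "x \<in> X \<Longrightarrow> gen V X x \<in> carrier (F X)"
  by (auto simp: free_alg_def intro: terms.Var)

lemma free_algebra: "is_algebra V (F X)"
  by (rule is_algebra_free_alg[OF V])

lemma free_in_variety: "in_variety V (F X)"
  by (rule in_variety_free_alg[OF V])

lemma free_alg_induct [consumes 1, case_names gen interp]:
  assumes "c \<in> carrier (F X)"
    and gen: "\<And>x. x \<in> X \<Longrightarrow> P (gen V X x)"
    and interp: "\<And>f cs. f \<in> symbols V \<Longrightarrow> length cs = arity V f \<Longrightarrow> set cs \<subseteq> carrier (F X) \<Longrightarrow>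
      \<forall>c\<in>set cs. P c \<Longrightarrow> P (interp (F X) f cs)"
  shows "P c"
proof -
  have "P (term_class V X t)" if "t \<in> terms V X" for t
    using that
  proof induction
    case (Var x) then show ?case by (rule gen)
  next
    case (Fn f ts)
    have "P (interp (F X) f (map (term_class V X) ts))"
      using Fn by (intro interp) (auto simp: free_alg_def)
    moreover have "set ts \<subseteq> terms V X" using Fn(3) by auto
    ultimately show ?case using interp_free_alg[OF V Fn(1,2), of X] by simp
  qed
  then show ?thesis using assms(1) by (auto simp: free_alg_def)
qed

text \<open>
  The target is an arbitrary structure of the signature, so the lemma applies to the derived algebras
  \<^term>\<open>star V w H\<close> before anything is known about the identities they satisfy.
\<close>

lemma Hom_free_eqI:
  assumes "\<mu> \<in> Hom V (F X) H" "\<nu> \<in> Hom V (F X) H" "\<And>x. x \<in> X \<Longrightarrow> \<mu> (gen V X x) = \<nu> (gen V X x)"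
  shows "\<mu> = \<nu>"
proof (rule extensionalityI[of _ "carrier (F X)"])
  fix c assume "c \<in> carrier (F X)"
  then show "\<mu> c = \<nu> c"
  proof (induction rule: free_alg_induct)
    case (interp f cs)
    then have "map \<mu> cs = map \<nu> cs" by simp
    then show ?case using interp(1-3) Hom_interp[OF assms(1)] Hom_interp[OF assms(2)] by metis
  qed (use assms in auto)
qed (rule Hom_extensional[OF assms(1)] Hom_extensional[OF assms(2)])+

lemma lift:
  assumes "in_variety V H" "\<And>x. x \<in> X \<Longrightarrow> a x \<in> carrier H"
  shows lift_Hom: "lift V X H a \<in> Hom V (F X) H"
    and lift_gen: "x \<in> X \<Longrightarrow> lift V X H a (gen V X x) = a x"
  using theI'[OF free_alg_universal[OF V assms(1), of a X]] assms(2) unfolding lift_def by auto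

lemma lift_eqI:
  assumes "in_variety V H" "\<mu> \<in> Hom V (F X) H" "\<And>x. x \<in> X \<Longrightarrow> \<mu> (gen V X x) = a x"
  shows "lift V X H a = \<mu>"
proof -
  have a: "a x \<in> carrier H" if "x \<in> X" for x
    using assms(3)[OF that, symmetric] Hom_closed[OF assms(2) gen_in_carrier[OF that]] by simp
  show ?thesis
  proof (rule Hom_free_eqI[OF lift_Hom[OF assms(1)] assms(2)])
    fix x assume x: "x \<in> X"
    have "lift V X H a (gen V X x) = a x" using assms(1) a x by (rule lift_gen)
    then show "lift V X H a (gen V X x) = \<mu> (gen V X x)" using assms(3)[OF x] by simp
  qed (rule a)
qed

section \<open>Verbal operations and derived algebras\<close>

lemma verbal_op_lift: "verbal_op V H k w hs = lift V {..<k} H (nth hs) w"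
  by (simp add: verbal_op_def lift_def lessThan_iff Ball_def)

text \<open>
  Following with \<open>\<nu>\<close> the homomorphism that evaluates words at \<open>hs\<close> gives the homomorphism that evaluates
  words at \<^term>\<open>map \<nu> hs\<close>, since the two agree on generators.
\<close>

lemma Hom_verbal_op:
  assumes "in_variety V H" "in_variety V K" "\<nu> \<in> Hom V H K"
    and "length hs = k" "set hs \<subseteq> carrier H" "w \<in> carrier (F {..<k})"
  shows "\<nu> (verbal_op V H k w hs) = verbal_op V K k w (map \<nu> hs)"
proof -
  define \<gamma> where "\<gamma> = lift V {..<k} H (nth hs)"
  have hs: "hs ! i \<in> carrier H" if "i \<in> {..<k}" for i using that assms(4,5) by auto
  have \<gamma>: "\<gamma> \<in> Hom V (F {..<k}) H"
    unfolding \<gamma>_def by (rule lift_Hom[OF assms(1)]) (rule hs)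
  have \<gamma>_gen: "\<gamma> (gen V {..<k} i) = hs ! i" if "i \<in> {..<k}" for i
    unfolding \<gamma>_def by (rule lift_gen[OF assms(1) _ that]) (rule hs)
  have "lift V {..<k} K (nth (map \<nu> hs)) = compose (carrier (F {..<k})) \<nu> \<gamma>"
  proof (rule lift_eqI[OF assms(2) Hom_compose[OF free_algebra \<gamma> assms(3)]])
    fix i assume i: "i \<in> {..<k}"
    then show "compose (carrier (F {..<k})) \<nu> \<gamma> (gen V {..<k} i) = map \<nu> hs ! i"
      using assms(4) by (simp add: compose_eq[OF gen_in_carrier[OF i]] \<gamma>_gen[OF i])
  qed
  then show ?thesis using assms(6) by (simp add: verbal_op_lift compose_eq \<gamma>_def)
qed

lemma Hom_star:
  assumes "Op1 V w" "in_variety V H" "in_variety V K" "\<nu> \<in> Hom V H K"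
  shows "\<nu> \<in> Hom V (star V w H) (star V w K)"
  unfolding Hom_def
proof (intro CollectI conjI ballI allI impI)
  show "\<nu> \<in> carrier (star V w H) \<rightarrow>\<^sub>E carrier (star V w K)"
    using assms(4) by (simp add: Hom_def star_def)
next
  fix f hs assume "f \<in> symbols V" "length hs = arity V f \<and> set hs \<subseteq> carrier (star V w H)"
  then show "\<nu> (interp (star V w H) f hs) = interp (star V w K) f (map \<nu> hs)"
    using Hom_verbal_op[OF assms(2-4), of hs "arity V f" "w f"] assms(1) by (simp add: star_def Op1_def)
qed

text \<open>
  An isomorphism of \<open>F X\<close> onto its own derived algebra that fixes the generators turns ordinary
  homomorphisms into homomorphisms to the derived algebra, and all of the latter arise so because
  both kinds are determined by their values on the generators.
\<close>

lemma Hom_to_star: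
  assumes "Op1 V w" "in_variety V H" "\<sigma> \<in> Iso V (F X) (star V w (F X))"
    and fix_gen: "\<And>x. x \<in> X \<Longrightarrow> \<sigma> (gen V X x) = gen V X x"
  shows "Hom V (F X) (star V w H) = (\<lambda>\<nu>. compose (carrier (F X)) \<nu> \<sigma>) ` Hom V (F X) H"
proof (intro equalityI subsetI)
  have comp: "compose (carrier (F X)) \<nu> \<sigma> \<in> Hom V (F X) (star V w H)" if "\<nu> \<in> Hom V (F X) H" for \<nu>
    using assms(3) Hom_star[OF assms(1) free_in_variety assms(2) that]
    by (intro Hom_compose[OF free_algebra]) (auto simp: Iso_def)
  then show "\<nu>' \<in> Hom V (F X) (star V w H)" if "\<nu>' \<in> (\<lambda>\<nu>. compose (carrier (F X)) \<nu> \<sigma>) ` Hom V (F X) H" for \<nu>'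
    using that by auto
  fix \<nu>' assume \<nu>': "\<nu>' \<in> Hom V (F X) (star V w H)"
  have c: "\<nu>' (gen V X x) \<in> carrier H" if "x \<in> X" for x
    using Hom_closed[OF \<nu>' gen_in_carrier[OF that]] by (simp add: star_def)
  define \<nu> where "\<nu> = lift V X H (\<lambda>x. \<nu>' (gen V X x))"
  have \<nu>: "\<nu> \<in> Hom V (F X) H"
    unfolding \<nu>_def by (rule lift_Hom[OF assms(2)]) (rule c)
  have \<nu>_gen: "\<nu> (gen V X x) = \<nu>' (gen V X x)" if "x \<in> X" for x
    unfolding \<nu>_def by (rule lift_gen[OF assms(2) _ that]) (rule c)
  have "\<nu>' = compose (carrier (F X)) \<nu> \<sigma>"
    using \<nu>' comp[OF \<nu>]
    by (rule Hom_free_eqI) (simp add: compose_eq gen_in_carrier fix_gen \<nu>_gen)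
  then show "\<nu>' \<in> (\<lambda>\<nu>. compose (carrier (F X)) \<nu> \<sigma>) ` Hom V (F X) H" using \<nu> by blast
qed

end

section \<open>Closed congruences\<close>

lemma Cl_iff:
  fixes H :: "('f, 'a) algebra" and B :: "('f, 'b) algebra"
  shows "T \<in> Cl V H B \<longleftrightarrow> T \<subseteq> carrier B \<times> carrier B \<and>
    (\<forall>a\<in>carrier B. \<forall>b\<in>carrier B.
      (\<forall>\<mu>\<in>Hom V B H. (\<forall>(x, y)\<in>T. \<mu> x = \<mu> y) \<longrightarrow> \<mu> a = \<mu> b) \<longrightarrow> (a, b) \<in> T)"
proof -
  have sol: "T \<subseteq> ker B \<mu> \<longleftrightarrow> (\<forall>(x, y)\<in>T. \<mu> x = \<mu> y)" if "T \<subseteq> carrier B \<times> carrier B" for \<mu> :: "'b \<Rightarrow> 'a"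
    using that by (auto simp: ker_def)
  have "(a, b) \<in> common_ker B (solutions V H B T) \<longleftrightarrow> a \<in> carrier B \<and> b \<in> carrier B \<and>
      (\<forall>\<mu>\<in>Hom V B H. (\<forall>(x, y)\<in>T. \<mu> x = \<mu> y) \<longrightarrow> \<mu> a = \<mu> b)"
    if "T \<subseteq> carrier B \<times> carrier B" for a b
    unfolding common_ker_def solutions_def sol[OF that] by (auto simp: ker_def)
  then show ?thesis unfolding Cl_def by auto
qed

lemma Cl_subset: "T \<in> Cl V H B \<Longrightarrow> T \<subseteq> carrier B \<times> carrier B"
  by (simp add: Cl_iff)

lemma Cl_memI:
  assumes "T \<in> Cl V H B" "a \<in> carrier B" "b \<in> carrier B"
    and "\<And>\<mu>. \<mu> \<in> Hom V B H \<Longrightarrow> (\<And>x y. (x, y) \<in> T \<Longrightarrow> \<mu> x = \<mu> y) \<Longrightarrow> \<mu> a = \<mu> b"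
  shows "(a, b) \<in> T"
proof (rule mp[OF bspec[OF bspec[OF conjunct2[OF assms(1)[unfolded Cl_iff]] assms(2)] assms(3)]])
  show "\<forall>\<mu>\<in>Hom V B H. (\<forall>(x, y)\<in>T. \<mu> x = \<mu> y) \<longrightarrow> \<mu> a = \<mu> b" using assms(4) by auto
qed

lemma Cl_equiv: assumes "T \<in> Cl V H B" shows "equiv (carrier B) T"
proof (rule equivI)
  note sub = Cl_subset[OF assms]
  show "T \<subseteq> carrier B \<times> carrier B" by (rule sub)
  show "refl_on (carrier B) T" by (rule refl_onI) (rule Cl_memI[OF assms], simp_all)
  show "sym T"
  proof (rule symI)
    fix x y assume xy: "(x, y) \<in> T"
    show "(y, x) \<in> T" 
    proof (rule Cl_memI[OF assms])
      fix \<mu> assume "\<And>x y. (x, y) \<in> T \<Longrightarrow> \<mu> x = \<mu> y"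
      then show "\<mu> y = \<mu> x" using xy by metis
    qed (use xy sub in auto)
  qed
  show "trans T"
  proof (rule transI)
    fix x y z assume xyz: "(x, y) \<in> T" "(y, z) \<in> T"
    show "(x, z) \<in> T"
    proof (rule Cl_memI[OF assms])
      fix \<mu> assume "\<And>x y. (x, y) \<in> T \<Longrightarrow> \<mu> x = \<mu> y"
      then show "\<mu> x = \<mu> z" using xyz by metis
    qed (use xyz sub in auto)
  qed
qed

lemma compose_nat_epi_eq_iff:
  assumes "T \<in> Cl V H B" "\<mu> \<in> Hom V A B" "\<nu> \<in> Hom V A B"
  shows "compose (carrier A) (nat_epi B T) \<mu> = compose (carrier A) (nat_epi B T) \<nu> \<longleftrightarrow>
    (\<forall>a\<in>carrier A. (\<mu> a, \<nu> a) \<in> T)"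
proof -
  have "nat_epi B T (\<mu> a) = nat_epi B T (\<nu> a) \<longleftrightarrow> (\<mu> a, \<nu> a) \<in> T" if "a \<in> carrier A" for a
    using eq_equiv_class_iff[OF Cl_equiv[OF assms(1)]] Hom_closed[OF assms(2) that] Hom_closed[OF assms(3) that]
    by (simp add: nat_epi_def)
  then show ?thesis
    by (auto simp: fun_eq_iff compose_def restrict_def)
qed

lemma map_prod_image_inject:
  assumes "inj_on \<phi> A" "T \<subseteq> A \<times> A" "T' \<subseteq> A \<times> A" "map_prod \<phi> \<phi> ` T = map_prod \<phi> \<phi> ` T'"
  shows "T = T'"
  using inj_on_image_eq_iff[OF map_prod_inj_on[OF assms(1,1)] assms(2,3)] assms(4) by simp

lemma map_prod_image_mem_iff:
  assumes "inj_on \<phi> A" "T \<subseteq> A \<times> A" "a \<in> A" "b \<in> A"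
  shows "(\<phi> a, \<phi> b) \<in> map_prod \<phi> \<phi> ` T \<longleftrightarrow> (a, b) \<in> T"
proof
  assume "(\<phi> a, \<phi> b) \<in> map_prod \<phi> \<phi> ` T"
  then obtain x y where xy: "(x, y) \<in> T" "\<phi> a = \<phi> x" "\<phi> b = \<phi> y" by auto
  then have "a = x" "b = y" using assms inj_onD[OF assms(1)] by blast+
  then show "(a, b) \<in> T" using xy by simp
qed (rule image_eqI[of _ _ "(a, b)"], simp_all)

text \<open>
  Closedness of a relation speaks only of homomorphisms to the test algebra, so a bijection of
  carriers that matches these homomorphisms matches the closed relations, whether or not it is itself
  a homomorphism.
\<close>

lemma Cl_transport:
  fixes A :: "('f, 'c) algebra" and B :: "('f, 'd) algebra" and H K :: "('f, 'b) algebra"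
  assumes bij: "bij_betw \<phi> (carrier A) (carrier B)"
    and Hom: "Hom V A H = (\<lambda>\<nu>. compose (carrier A) \<nu> \<phi>) ` Hom V B K"
    and T: "T \<subseteq> carrier A \<times> carrier A"
  shows "T \<in> Cl V H A \<longleftrightarrow> map_prod \<phi> \<phi> ` T \<in> Cl V K B"
proof -
  have B: "carrier B = \<phi> ` carrier A" using bij by (simp add: bij_betw_def)
  have inj: "inj_on \<phi> (carrier A)" using bij by (simp add: bij_betw_def)
  define U where "U = map_prod \<phi> \<phi> ` T"
  have mem: "(\<phi> a, \<phi> b) \<in> U \<longleftrightarrow> (a, b) \<in> T" if "a \<in> carrier A" "b \<in> carrier A" for a b
    unfolding U_def using inj T that by (rule map_prod_image_mem_iff)
  have sub: "U \<subseteq> carrier B \<times> carrier B"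
    unfolding U_def B using T by (auto simp: map_prod_def)
  have sol: "(\<forall>(x, y)\<in>T. compose (carrier A) \<nu> \<phi> x = compose (carrier A) \<nu> \<phi> y) \<longleftrightarrow> (\<forall>(x, y)\<in>U. \<nu> x = \<nu> y)"
    for \<nu> :: "'d \<Rightarrow> 'b"
  proof -
    have "(\<forall>(x, y)\<in>T. compose (carrier A) \<nu> \<phi> x = compose (carrier A) \<nu> \<phi> y) \<longleftrightarrow> (\<forall>(x, y)\<in>T. \<nu> (\<phi> x) = \<nu> (\<phi> y))"
      using T by (intro ball_cong) (auto simp: compose_eq)
    also have "\<dots> \<longleftrightarrow> (\<forall>(x, y)\<in>U. \<nu> x = \<nu> y)" by (simp add: U_def case_prod_beta)
    finally show ?thesis .
  qed
  have eq: "(\<forall>\<mu>\<in>Hom V A H. (\<forall>(x, y)\<in>T. \<mu> x = \<mu> y) \<longrightarrow> \<mu> a = \<mu> b) \<longleftrightarrow>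
      (\<forall>\<nu>\<in>Hom V B K. (\<forall>(x, y)\<in>U. \<nu> x = \<nu> y) \<longrightarrow> \<nu> (\<phi> a) = \<nu> (\<phi> b))"
    if "a \<in> carrier A" "b \<in> carrier A" for a b
    unfolding Hom ball_simps(9) sol compose_eq[OF that(1)] compose_eq[OF that(2)] ..
  have "T \<in> Cl V H A \<longleftrightarrow> (\<forall>a\<in>carrier A. \<forall>b\<in>carrier A.
      (\<forall>\<mu>\<in>Hom V A H. (\<forall>(x, y)\<in>T. \<mu> x = \<mu> y) \<longrightarrow> \<mu> a = \<mu> b) \<longrightarrow> (a, b) \<in> T)"
    unfolding Cl_iff using T by (simp only: simp_thms)
  also have "\<dots> \<longleftrightarrow> (\<forall>a\<in>carrier A. \<forall>b\<in>carrier A.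
      (\<forall>\<nu>\<in>Hom V B K. (\<forall>(x, y)\<in>U. \<nu> x = \<nu> y) \<longrightarrow> \<nu> (\<phi> a) = \<nu> (\<phi> b)) \<longrightarrow> (\<phi> a, \<phi> b) \<in> U)"
    by (intro ball_cong refl) (simp_all only: eq mem)
  also have "\<dots> \<longleftrightarrow> (\<forall>a\<in>carrier B. \<forall>b\<in>carrier B.
      (\<forall>\<nu>\<in>Hom V B K. (\<forall>(x, y)\<in>U. \<nu> x = \<nu> y) \<longrightarrow> \<nu> a = \<nu> b) \<longrightarrow> (a, b) \<in> U)"
    by (simp only: B ball_simps(9))
  also have "\<dots> \<longleftrightarrow> U \<in> Cl V K B"
    unfolding Cl_iff using sub by (simp only: simp_thms)
  finally show ?thesis by (simp only: U_def)
qed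

text \<open>
  A closed relation is an intersection of kernels of homomorphisms \<open>\<rho>\<close> to \<open>H\<close>, and for each of these
  \<open>\<rho> \<circ> \<mu>\<close> and \<open>\<rho> \<circ> \<nu>\<close> are homomorphisms that agree on the generators.
\<close>

lemma (in equational_class) Cl_agree_on_gens:
  assumes "T \<in> Cl V H B" "\<mu> \<in> Hom V (F X) B" "\<nu> \<in> Hom V (F X) B"
    and gens: "\<And>x. x \<in> X \<Longrightarrow> (\<mu> (gen V X x), \<nu> (gen V X x)) \<in> T" and c: "c \<in> carrier (F X)"
  shows "(\<mu> c, \<nu> c) \<in> T"
proof (rule Cl_memI[OF assms(1)])
  fix \<rho> assume \<rho>: "\<rho> \<in> Hom V B H" and T: "\<And>x y. (x, y) \<in> T \<Longrightarrow> \<rho> x = \<rho> y"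
  have "compose (carrier (F X)) \<rho> \<mu> = compose (carrier (F X)) \<rho> \<nu>"
  proof (rule Hom_free_eqI)
    fix x assume "x \<in> X"
    then show "compose (carrier (F X)) \<rho> \<mu> (gen V X x) = compose (carrier (F X)) \<rho> \<nu> (gen V X x)"
      using T gens by (simp add: compose_eq gen_in_carrier)
  qed (rule Hom_compose[OF free_algebra _ \<rho>], fact)+
  from fun_cong[OF this, of c] show "\<rho> (\<mu> c) = \<rho> (\<nu> c)" using c by (simp add: compose_eq)
qed (rule Hom_closed[OF assms(2) c] Hom_closed[OF assms(3) c])+

section \<open>Words define an automorphism\<close>

context equational_class begin

text \<open>
  The automorphism is the identity on objects and conjugation by the permutations \<open>\<sigma>\<close> on morphisms; the
  closed relations correspond under \<open>\<sigma> \<times> \<sigma>\<close>.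
\<close>

lemma automorphically_equivalent_if_words:
  assumes w: "Op1 V w" "Op2 V w" and H2: "in_variety V H\<^sub>2"
    and geo: "geometrically_equivalent V H\<^sub>1 (star V w H\<^sub>2)"
  shows "automorphically_equivalent V H\<^sub>1 H\<^sub>2"
proof -
  have "\<forall>A\<in>free_obs V. \<exists>\<sigma>. \<exists>X. A = F X \<and> \<sigma> \<in> Iso V A (star V w A) \<and> (\<forall>x\<in>X. \<sigma> (gen V X x) = gen V X x)"
    using w(2) unfolding free_obs_def Op2_def by blast
  then obtain \<sigma> where \<sigma>: "\<And>A. A \<in> free_obs V \<Longrightarrow>
      \<exists>X. A = F X \<and> \<sigma> A \<in> Iso V A (star V w A) \<and> (\<forall>x\<in>X. \<sigma> A (gen V X x) = gen V X x)"
    by (metis (no_types, lifting))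
  have Iso: "\<sigma> A \<in> Iso V A (star V w A)" if "A \<in> free_obs V" for A using \<sigma>[OF that] by blast
  have bij: "bij_betw (\<sigma> A) (carrier A) (carrier A)" if "A \<in> free_obs V" for A
    using Iso[OF that] by (simp add: Iso_def star_def)
  have Hom_star_eq: "Hom V A (star V w K) = (\<lambda>\<nu>. compose (carrier A) \<nu> (\<sigma> A)) ` Hom V A K"
    if "A \<in> free_obs V" "in_variety V K" for A and K :: "('f, 'c) algebra"
    using \<sigma>[OF that(1)] Hom_to_star[OF w(1) that(2)] by blast
  have alg: "is_algebra V A" "in_variety V A" if "A \<in> free_obs V" for A
    using that free_algebra free_in_variety by (auto simp: free_obs_def)
  define \<tau> where "\<tau> A = inv_into (carrier A) (\<sigma> A)" for A
  have \<tau>: "\<tau> A a \<in> carrier A" "\<sigma> A (\<tau> A a) = a" "\<tau> A (\<sigma> A a) = a" "\<sigma> A a \<in> carrier A"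
    if "A \<in> free_obs V" "a \<in> carrier A" for A a
    using bij[OF that(1)] that(2) inv_into_into[of a "\<sigma> A" "carrier A"] f_inv_into_f[of a "\<sigma> A" "carrier A"]
    by (simp_all add: \<tau>_def bij_betw_def) blast
  define \<Phi> where "\<Phi> A B \<mu> = (\<lambda>a\<in>carrier A. \<sigma> B (\<mu> (\<tau> A a)))" for A B \<mu>
  \<comment> \<open>Conjugation by \<open>\<sigma>\<close> preserves homomorphisms: \<open>\<sigma> B \<circ> \<mu>\<close> maps into the derived algebra of \<open>B\<close>,
    hence factors through \<open>\<sigma> A\<close>.\<close>
  have \<Phi>_Hom: "\<Phi> A B \<mu> \<in> Hom V A B" if AB: "A \<in> free_obs V" "B \<in> free_obs V" and \<mu>: "\<mu> \<in> Hom V A B" for A B \<mu>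
  proof -
    have "compose (carrier A) (\<sigma> B) \<mu> \<in> Hom V A (star V w B)"
      using Iso[OF AB(2)] \<mu> by (intro Hom_compose[OF alg(1)[OF AB(1)]]) (auto simp: Iso_def)
    then obtain \<nu> where \<nu>: "\<nu> \<in> Hom V A B" "compose (carrier A) (\<sigma> B) \<mu> = compose (carrier A) \<nu> (\<sigma> A)"
      using Hom_star_eq[OF AB(1) alg(2)[OF AB(2)]] by blast
    have "\<Phi> A B \<mu> = \<nu>"
    proof (rule extensionalityI[of _ "carrier A"])
      fix a assume a: "a \<in> carrier A"
      then show "\<Phi> A B \<mu> a = \<nu> a"
        using fun_cong[OF \<nu>(2), of "\<tau> A a"] \<tau>[OF AB(1) a] by (simp add: \<Phi>_def compose_eq)
    qed (auto simp: \<Phi>_def Hom_extensional[OF \<nu>(1)])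
    then show ?thesis using \<nu> by simp
  qed
  have \<Phi>_\<sigma>: "\<Phi> A B \<mu> (\<sigma> A a) = \<sigma> B (\<mu> a)" if "A \<in> free_obs V" "a \<in> carrier A" for A B \<mu> a
    using \<tau>[OF that] by (simp add: \<Phi>_def)
  have \<Phi>_bij: "bij_betw (\<Phi> A B) (Hom V A B) (Hom V A B)" if AB: "A \<in> free_obs V" "B \<in> free_obs V" for A B
  proof (rule bij_betw_imageI)
    show "inj_on (\<Phi> A B) (Hom V A B)"
    proof (rule inj_onI)
      fix \<mu> \<nu> assume \<mu>: "\<mu> \<in> Hom V A B" and \<nu>: "\<nu> \<in> Hom V A B" and eq: "\<Phi> A B \<mu> = \<Phi> A B \<nu>"
      show "\<mu> = \<nu>"
      proof (rule extensionalityI[of _ "carrier A"])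
        fix a assume a: "a \<in> carrier A"
        then have "\<sigma> B (\<mu> a) = \<sigma> B (\<nu> a)" using eq \<Phi>_\<sigma>[OF AB(1) a] by metis
        then show "\<mu> a = \<nu> a" using \<tau>(3)[OF AB(2)] Hom_closed[OF \<mu> a] Hom_closed[OF \<nu> a] by metis
      qed (use \<mu> \<nu> Hom_extensional in auto)
    qed
    show "\<Phi> A B ` Hom V A B = Hom V A B"
    proof (intro equalityI subsetI)
      fix \<nu> assume \<nu>: "\<nu> \<in> Hom V A B"
      have \<nu>\<sigma>: "compose (carrier A) \<nu> (\<sigma> A) \<in> Hom V A (star V w B)"
        using \<nu> Hom_star_eq[OF AB(1) alg(2)[OF AB(2)]] by blast
      have inv: "restrict (\<tau> B) (carrier B) \<in> Hom V (star V w B) B"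
        using Iso_inverse[OF alg(1)[OF AB(2)] Iso[OF AB(2)]] by (simp add: \<tau>_def star_def)
      define \<mu> where "\<mu> = compose (carrier A) (restrict (\<tau> B) (carrier B)) (compose (carrier A) \<nu> (\<sigma> A))"
      have "\<mu> \<in> Hom V A B" unfolding \<mu>_def using Hom_compose[OF alg(1)[OF AB(1)] \<nu>\<sigma> inv] .
      moreover have "\<Phi> A B \<mu> = \<nu>"
      proof (rule extensionalityI[of _ "carrier A"])
        fix a assume a: "a \<in> carrier A"
        then show "\<Phi> A B \<mu> a = \<nu> a"
          using \<tau>[OF AB(1) a] \<tau>[OF AB(2) Hom_closed[OF \<nu> a]] Hom_closed[OF \<nu> a]
          by (simp add: \<Phi>_def \<mu>_def compose_eq)
      qed (auto simp: \<Phi>_def Hom_extensional[OF \<nu>])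
      ultimately show "\<nu> \<in> \<Phi> A B ` Hom V A B" by blast
    qed (use \<Phi>_Hom[OF AB] in auto)
  qed
  have aut: "category_automorphism V id \<Phi>"
    unfolding category_automorphism_def
  proof (intro conjI ballI)
    fix A assume A: "A \<in> free_obs V"
    show "\<Phi> A A (restrict id (carrier A)) = restrict id (carrier (id A))"
      using \<tau>[OF A] by (auto simp: \<Phi>_def restrict_def fun_eq_iff)
    fix B C \<mu> \<nu> assume "B \<in> free_obs V" "C \<in> free_obs V" "\<mu> \<in> Hom V A B" "\<nu> \<in> Hom V B C"
    then show "\<Phi> A C (compose (carrier A) \<nu> \<mu>) = compose (carrier (id A)) (\<Phi> B C \<nu>) (\<Phi> A B \<mu>)"
      using \<tau>[OF A] \<tau>[of B] Hom_closed[of \<mu> V A B]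
      by (auto simp: \<Phi>_def compose_def restrict_def fun_eq_iff)
  qed (simp_all add: \<Phi>_bij)
  define \<alpha> where "\<alpha> A T = map_prod (\<sigma> A) (\<sigma> A) ` T" for A T
  have Cl_star: "T \<in> Cl V H\<^sub>1 A \<longleftrightarrow> \<alpha> A T \<in> Cl V H\<^sub>2 A" if "A \<in> free_obs V" "T \<subseteq> carrier A \<times> carrier A" for A T
    using geo that Cl_transport[OF bij Hom_star_eq[OF _ H2]]
    by (simp add: geometrically_equivalent_def \<alpha>_def)
  have inj: "inj_on (\<sigma> A) (carrier A)" if "A \<in> free_obs V" for A using bij[OF that] by (simp add: bij_betw_def)
  have \<alpha>_bij: "bij_betw (\<alpha> A) (Cl V H\<^sub>1 A) (Cl V H\<^sub>2 A)" if A: "A \<in> free_obs V" for A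
  proof (rule bij_betw_imageI)
    show "inj_on (\<alpha> A) (Cl V H\<^sub>1 A)"
      unfolding \<alpha>_def by (rule inj_onI) (rule map_prod_image_inject[OF inj[OF A] Cl_subset Cl_subset])
    show "\<alpha> A ` Cl V H\<^sub>1 A = Cl V H\<^sub>2 A"
    proof (intro equalityI subsetI)
      fix U assume U: "U \<in> Cl V H\<^sub>2 A"
      define T where "T = map_prod (\<tau> A) (\<tau> A) ` U"
      have sub: "T \<subseteq> carrier A \<times> carrier A" using Cl_subset[OF U] \<tau>[OF A] by (auto simp: T_def)
      have "\<alpha> A T = (\<lambda>p. p) ` U"
        unfolding \<alpha>_def T_def image_image using Cl_subset[OF U] \<tau>(2)[OF A] by (intro image_cong) auto
      then show "U \<in> \<alpha> A ` Cl V H\<^sub>1 A" using U Cl_star[OF A sub] by (intro image_eqI[of _ _ T]) auto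
    qed (use Cl_star[OF A] Cl_subset in blast)
  qed
  have "compose (carrier A) (nat_epi B T) \<mu> = compose (carrier A) (nat_epi B T) \<nu> \<longleftrightarrow>
      compose (carrier A) (nat_epi B (\<alpha> B T)) (\<Phi> A B \<mu>) = compose (carrier A) (nat_epi B (\<alpha> B T)) (\<Phi> A B \<nu>)"
    if AB: "A \<in> free_obs V" "B \<in> free_obs V" and \<mu>: "\<mu> \<in> Hom V A B" and \<nu>: "\<nu> \<in> Hom V A B"
      and T: "T \<in> Cl V H\<^sub>1 B" for A B \<mu> \<nu> T
  proof -
    have \<alpha>T: "\<alpha> B T \<in> Cl V H\<^sub>2 B" using \<alpha>_bij[OF AB(2)] T by (auto simp: bij_betw_def)
    have mem: "(\<sigma> B (\<mu> a), \<sigma> B (\<nu> a)) \<in> \<alpha> B T \<longleftrightarrow> (\<mu> a, \<nu> a) \<in> T" if "a \<in> carrier A" for a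
      unfolding \<alpha>_def
      by (rule map_prod_image_mem_iff[OF inj[OF AB(2)] Cl_subset[OF T] Hom_closed[OF \<mu> that] Hom_closed[OF \<nu> that]])
    have "(\<forall>a\<in>carrier A. (\<Phi> A B \<mu> a, \<Phi> A B \<nu> a) \<in> \<alpha> B T) \<longleftrightarrow> (\<forall>a\<in>\<sigma> A ` carrier A. (\<Phi> A B \<mu> a, \<Phi> A B \<nu> a) \<in> \<alpha> B T)"
      using bij[OF AB(1)] by (simp add: bij_betw_def)
    also have "\<dots> \<longleftrightarrow> (\<forall>a\<in>carrier A. (\<mu> a, \<nu> a) \<in> T)"
      using \<Phi>_\<sigma>[OF AB(1)] mem by simp
    finally show ?thesis
      using compose_nat_epi_eq_iff[OF T \<mu> \<nu>] compose_nat_epi_eq_iff[OF \<alpha>T \<Phi>_Hom[OF AB \<mu>] \<Phi>_Hom[OF AB \<nu>]] by simp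
  qed
  with aut \<alpha>_bij show ?thesis
    unfolding automorphically_equivalent_def by (intro exI[of _ id] exI[of _ \<Phi>] exI[of _ \<alpha>]) simp
qed

end

section \<open>Free bases\<close>

context equational_class begin

lemma free_obsI: "finite X \<Longrightarrow> F X \<in> free_obs V"
  by (auto simp: free_obs_def)

lemma free_obsE: assumes "A \<in> free_obs V" obtains X where "finite X" "A = F X"
  using assms by (auto simp: free_obs_def)

lemma free_obs_in_variety: "A \<in> free_obs V \<Longrightarrow> in_variety V A"
  using free_in_variety by (auto simp: free_obs_def)

lemma free_obs_algebra: "A \<in> free_obs V \<Longrightarrow> is_algebra V A"
  using free_algebra by (auto simp: free_obs_def)

text \<open>Freeness is tested against the objects of the category only, so that an automorphism can transport it.\<close>

definition free_basis :: "'i set \<Rightarrow> ('i \<Rightarrow> 'f trm set) \<Rightarrow> ('f, 'f trm set) algebra \<Rightarrow> bool" where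
  "free_basis I g A \<longleftrightarrow> A \<in> free_obs V \<and> (\<forall>i\<in>I. g i \<in> carrier A) \<and>
    (\<forall>B\<in>free_obs V.
      (\<forall>c. (\<forall>i\<in>I. c i \<in> carrier B) \<longrightarrow> (\<exists>\<mu>\<in>Hom V A B. \<forall>i\<in>I. \<mu> (g i) = c i)) \<and>
      (\<forall>\<mu>\<in>Hom V A B. \<forall>\<nu>\<in>Hom V A B. (\<forall>i\<in>I. \<mu> (g i) = \<nu> (g i)) \<longrightarrow> \<mu> = \<nu>))"

lemma free_basis_extend:
  assumes "free_basis I g A" "B \<in> free_obs V" "\<And>i. i \<in> I \<Longrightarrow> c i \<in> carrier B"
  obtains \<mu> where "\<mu> \<in> Hom V A B" "\<And>i. i \<in> I \<Longrightarrow> \<mu> (g i) = c i"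
proof -
  have "(\<forall>i\<in>I. c i \<in> carrier B) \<longrightarrow> (\<exists>\<mu>\<in>Hom V A B. \<forall>i\<in>I. \<mu> (g i) = c i)"
    using assms(1,2) by (simp add: free_basis_def)
  then obtain \<mu> where "\<mu> \<in> Hom V A B" "\<forall>i\<in>I. \<mu> (g i) = c i" using assms(3) by auto
  then show thesis by (intro that[of \<mu>]) auto
qed

lemma free_basis_eqI:
  assumes "free_basis I g A" "B \<in> free_obs V" "\<mu> \<in> Hom V A B" "\<nu> \<in> Hom V A B"
    and "\<And>i. i \<in> I \<Longrightarrow> \<mu> (g i) = \<nu> (g i)"
  shows "\<mu> = \<nu>"
proof -
  have "\<forall>\<mu>\<in>Hom V A B. \<forall>\<nu>\<in>Hom V A B. (\<forall>i\<in>I. \<mu> (g i) = \<nu> (g i)) \<longrightarrow> \<mu> = \<nu>"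
    using assms(1,2) by (simp add: free_basis_def)
  from bspec[OF bspec[OF this assms(3)] assms(4)] show ?thesis using assms(5) by simp
qed

lemma free_basis_reindex:
  assumes basis: "free_basis I g A" and e: "bij_betw e J I"
  shows "free_basis J (\<lambda>j. g (e j)) A"
  unfolding free_basis_def
proof (intro conjI ballI allI impI)
  have eJ: "e j \<in> I" if "j \<in> J" for j using bij_betwE[OF e] that by blast
  show "A \<in> free_obs V" using basis by (simp add: free_basis_def)
  show "g (e j) \<in> carrier A" if "j \<in> J" for j using basis eJ[OF that] by (simp add: free_basis_def)
  fix B assume B: "B \<in> free_obs V"
  show "\<exists>\<mu>\<in>Hom V A B. \<forall>j\<in>J. \<mu> (g (e j)) = c j" if c: "\<forall>j\<in>J. c j \<in> carrier B" for c
  proof -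
    have c': "c (inv_into J e i) \<in> carrier B" if "i \<in> I" for i
      using c bij_betwE[OF bij_betw_inv_into[OF e]] that by blast
    obtain \<mu> where \<mu>: "\<mu> \<in> Hom V A B" "\<And>i. i \<in> I \<Longrightarrow> \<mu> (g i) = c (inv_into J e i)"
      by (rule free_basis_extend[OF basis B, of "\<lambda>i. c (inv_into J e i)"]) (use c' in auto)
    have "\<mu> (g (e j)) = c j" if "j \<in> J" for j
      using \<mu>(2)[OF eJ[OF that]] bij_betw_inv_into_left[OF e that] by simp
    then show ?thesis using \<mu>(1) by blast
  qed
  show "\<mu> = \<nu>" if "\<mu> \<in> Hom V A B" "\<nu> \<in> Hom V A B" "\<forall>j\<in>J. \<mu> (g (e j)) = \<nu> (g (e j))" for \<mu> \<nu>
  proof (rule free_basis_eqI[OF basis B that(1,2)])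
    fix i assume "i \<in> I"
    then obtain j where "j \<in> J" "i = e j" using e by (auto simp: bij_betw_def)
    then show "\<mu> (g i) = \<nu> (g i)" using that(3) by simp
  qed
qed

lemma free_basis_Iso:
  assumes basis: "free_basis X g A" and X: "finite X"
  shows "lift V X A g \<in> Iso V (F X) A"
proof -
  have A: "A \<in> free_obs V" and g: "\<And>x. x \<in> X \<Longrightarrow> g x \<in> carrier A"
    using basis by (auto simp: free_basis_def)
  define s where "s = lift V X A g"
  have s: "s \<in> Hom V (F X) A"
    unfolding s_def by (rule lift_Hom[OF free_obs_in_variety[OF A] g])
  have s_gen: "s (gen V X x) = g x" if "x \<in> X" for x
    unfolding s_def by (rule lift_gen[OF free_obs_in_variety[OF A] g that])
  obtain t where t: "t \<in> Hom V A (F X)" and t_g: "\<And>x. x \<in> X \<Longrightarrow> t (g x) = gen V X x"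
    by (rule free_basis_extend[OF basis free_obsI[OF X], of "gen V X"]) (auto simp: gen_in_carrier)
  have "compose (carrier (F X)) t s = restrict id (carrier (F X))"
    by (rule Hom_free_eqI[OF Hom_compose[OF free_algebra s t] Hom_id[OF free_algebra]])
      (simp add: compose_eq gen_in_carrier s_gen t_g)
  from fun_cong[OF this] have ts: "t (s a) = a" if "a \<in> carrier (F X)" for a
    using that by (metis compose_eq restrict_apply' id_apply)
  have "compose (carrier A) s t = restrict id (carrier A)"
    by (rule free_basis_eqI[OF basis A Hom_compose[OF free_obs_algebra[OF A] t s] Hom_id[OF free_obs_algebra[OF A]]])
      (simp add: compose_eq g s_gen t_g)
  from fun_cong[OF this] have st: "s (t a) = a" if "a \<in> carrier A" for a
    using that by (metis compose_eq restrict_apply' id_apply)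
  have "bij_betw s (carrier (F X)) (carrier A)"
    by (rule bij_betw_byWitness[where f' = t]) (use ts st Hom_closed[OF s] Hom_closed[OF t] in auto)
  then show ?thesis using s by (simp add: Iso_def s_def)
qed

lemma free_basis_card:
  assumes ibn: "IBN_variety V" and basis: "free_basis I g (F Y)" and fin: "finite I" "finite Y"
  shows "card I = card Y"
proof -
  obtain e where e: "bij_betw e {0..<card I} I" using ex_bij_betw_nat_finite[OF fin(1)] by blast
  have "Iso V (F {0..<card I}) (F Y) \<noteq> {}"
    using free_basis_Iso[OF free_basis_reindex[OF basis e]] by blast
  then have "card {0..<card I} = card Y" using ibn fin(2) unfolding IBN_variety_def by blast
  then show ?thesis by simp
qed

text \<open>
  Elements of an object \<open>A\<close> are the morphisms from the free algebra on one generator to \<open>A\<close>. This is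
  how an automorphism, given only on objects and morphisms, acts on elements.
\<close>

definition elt :: "('f, 'f trm set) algebra \<Rightarrow> 'f trm set \<Rightarrow> 'f trm set \<Rightarrow> 'f trm set" where
  "elt A a = lift V {0} A (\<lambda>_. a)"

lemma elt_Hom: "A \<in> free_obs V \<Longrightarrow> a \<in> carrier A \<Longrightarrow> elt A a \<in> Hom V (F {0}) A"
  unfolding elt_def by (rule lift_Hom[OF free_obs_in_variety])

lemma elt_gen: "A \<in> free_obs V \<Longrightarrow> a \<in> carrier A \<Longrightarrow> elt A a (gen V {0} 0) = a"
  unfolding elt_def by (rule lift_gen[OF free_obs_in_variety]) auto

lemma elt_inject:
  assumes "A \<in> free_obs V" "a \<in> carrier A" "b \<in> carrier A" "elt A a = elt A b"
  shows "a = b"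
  using fun_cong[OF assms(4), of "gen V {0} 0"] unfolding elt_gen[OF assms(1,2)] elt_gen[OF assms(1,3)] .

lemma elt_eta: "A \<in> free_obs V \<Longrightarrow> \<theta> \<in> Hom V (F {0}) A \<Longrightarrow> elt A (\<theta> (gen V {0} 0)) = \<theta>"
  unfolding elt_def by (rule lift_eqI[OF free_obs_in_variety]) auto

lemma elt_compose:
  assumes "A \<in> free_obs V" "B \<in> free_obs V" "\<mu> \<in> Hom V A B" "a \<in> carrier A"
  shows "compose (carrier (F {0})) \<mu> (elt A a) = elt B (\<mu> a)"
  using elt_eta[OF assms(2) Hom_compose[OF free_algebra elt_Hom[OF assms(1,4)] assms(3)]]
  by (simp add: compose_eq gen_in_carrier elt_gen[OF assms(1,4)])

end

section \<open>Automorphisms acting on elements\<close>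

locale free_automorphism = equational_class V for V :: "'f variety" +
  fixes \<Phi>\<^sub>o :: "'f ob_map" and \<Phi>\<^sub>m :: "'f mor_map"
  assumes automorphism: "category_automorphism V \<Phi>\<^sub>o \<Phi>\<^sub>m"
begin

lemma ob_bij: "bij_betw \<Phi>\<^sub>o (free_obs V) (free_obs V)"
  by (rule conjunct1[OF automorphism[unfolded category_automorphism_def]])

lemma ob_closed: "A \<in> free_obs V \<Longrightarrow> \<Phi>\<^sub>o A \<in> free_obs V"
  by (rule bspec[OF bij_betwE[OF ob_bij]])

lemma ob_surj: assumes "B \<in> free_obs V" obtains A where "A \<in> free_obs V" "\<Phi>\<^sub>o A = B"
proof -
  have "B \<in> \<Phi>\<^sub>o ` free_obs V" using bij_betw_imp_surj_on[OF ob_bij] assms by simp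
  then show ?thesis by (rule imageE) (simp add: that)
qed

lemma mor_bij:
  "A \<in> free_obs V \<Longrightarrow> B \<in> free_obs V \<Longrightarrow>
    bij_betw (\<Phi>\<^sub>m A B) (Hom V A B) (Hom V (\<Phi>\<^sub>o A) (\<Phi>\<^sub>o B))"
  by (rule bspec[OF bspec[OF conjunct1[OF conjunct2[OF automorphism[unfolded category_automorphism_def]]]]])

lemma mor_closed:
  "A \<in> free_obs V \<Longrightarrow> B \<in> free_obs V \<Longrightarrow> \<mu> \<in> Hom V A B \<Longrightarrow> \<Phi>\<^sub>m A B \<mu> \<in> Hom V (\<Phi>\<^sub>o A) (\<Phi>\<^sub>o B)"
  by (rule bspec[OF bij_betwE[OF mor_bij]])

lemma mor_surj:
  assumes "A \<in> free_obs V" "B \<in> free_obs V" "\<nu> \<in> Hom V (\<Phi>\<^sub>o A) (\<Phi>\<^sub>o B)"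
  obtains \<mu> where "\<mu> \<in> Hom V A B" "\<Phi>\<^sub>m A B \<mu> = \<nu>"
proof -
  have "\<nu> \<in> \<Phi>\<^sub>m A B ` Hom V A B"
    using bij_betw_imp_surj_on[OF mor_bij[OF assms(1,2)]] assms(3) by simp
  then show ?thesis by (rule imageE) (simp add: that)
qed

lemma mor_inject:
  assumes "A \<in> free_obs V" "B \<in> free_obs V" "\<mu> \<in> Hom V A B" "\<nu> \<in> Hom V A B" "\<Phi>\<^sub>m A B \<mu> = \<Phi>\<^sub>m A B \<nu>"
  shows "\<mu> = \<nu>"
  using inj_onD[OF bij_betw_imp_inj_on[OF mor_bij[OF assms(1,2)]] assms(5,3,4)] .

lemma mor_compose:
  assumes "A \<in> free_obs V" "B \<in> free_obs V" "C \<in> free_obs V" "\<mu> \<in> Hom V A B" "\<nu> \<in> Hom V B C"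
    and "a \<in> carrier (\<Phi>\<^sub>o A)"
  shows "\<Phi>\<^sub>m A C (compose (carrier A) \<nu> \<mu>) a = \<Phi>\<^sub>m B C \<nu> (\<Phi>\<^sub>m A B \<mu> a)"
proof -
  have "\<Phi>\<^sub>m A C (compose (carrier A) \<nu> \<mu>) = compose (carrier (\<Phi>\<^sub>o A)) (\<Phi>\<^sub>m B C \<nu>) (\<Phi>\<^sub>m A B \<mu>)"
    by (rule bspec[OF bspec[OF bspec[OF bspec[OF bspec[OF conjunct2[OF conjunct2[OF conjunct2[OF
      automorphism[unfolded category_automorphism_def]]]] assms(1)] assms(2)] assms(3)] assms(4)] assms(5)])
  then show ?thesis using assms(6) by (simp add: compose_eq)
qed

lemma mor_elt:
  assumes "A \<in> free_obs V" "B \<in> free_obs V" "\<mu> \<in> Hom V A B" "a \<in> carrier A" "c \<in> carrier (\<Phi>\<^sub>o (F {0}))"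
  shows "\<Phi>\<^sub>m A B \<mu> (\<Phi>\<^sub>m (F {0}) A (elt A a) c) = \<Phi>\<^sub>m (F {0}) B (elt B (\<mu> a)) c"
  using mor_compose[OF free_obsI assms(1,2) elt_Hom[OF assms(1,4)] assms(3,5)]
  unfolding elt_compose[OF assms(1-4)] by (simp only: finite.intros)

text \<open>
  \<open>F P\<close> is the coproduct of copies of \<^term>\<open>F {0}\<close> indexed by \<open>P\<close>, and an automorphism preserves
  coproducts, so \<open>\<Phi>\<^sub>o (F P)\<close> is the coproduct of \<open>P\<close> copies of \<open>F Q\<close>; its free basis consists of the
  images of the generators of \<open>F Q\<close> under the \<open>P\<close> injections.
\<close>

lemma free_basis_image:
  assumes P: "finite P" and Q: "finite Q" "\<Phi>\<^sub>o (F {0}) = F Q"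
  shows "free_basis (P \<times> Q) (\<lambda>i. \<Phi>\<^sub>m (F {0}) (F P) (elt (F P) (gen V P (fst i))) (gen V Q (snd i))) (\<Phi>\<^sub>o (F P))"
  unfolding free_basis_def
proof (intro conjI ballI allI impI)
  have F1: "F {0} \<in> free_obs V" and FP: "F P \<in> free_obs V" using P by (auto intro: free_obsI)
  have genQ: "gen V Q q \<in> carrier (\<Phi>\<^sub>o (F {0}))" if "q \<in> Q" for q
    using gen_in_carrier[OF that] Q(2) by simp
  have image_gen: "\<Phi>\<^sub>m (F P) B \<mu> (\<Phi>\<^sub>m (F {0}) (F P) (elt (F P) (gen V P p)) (gen V Q q)) =
      \<Phi>\<^sub>m (F {0}) B (elt B (\<mu> (gen V P p))) (gen V Q q)"
    if "B \<in> free_obs V" "\<mu> \<in> Hom V (F P) B" "p \<in> P" "q \<in> Q" for B \<mu> p q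
    by (rule mor_elt[OF FP that(1,2) gen_in_carrier[OF that(3)] genQ[OF that(4)]])
  show "\<Phi>\<^sub>o (F P) \<in> free_obs V" by (rule ob_closed[OF FP])
  show "\<Phi>\<^sub>m (F {0}) (F P) (elt (F P) (gen V P (fst i))) (gen V Q (snd i)) \<in> carrier (\<Phi>\<^sub>o (F P))" if "i \<in> P \<times> Q" for i
  proof -
    have "fst i \<in> P" "snd i \<in> Q" using that by auto
    then show ?thesis
      by (intro Hom_closed[OF mor_closed[OF F1 FP elt_Hom[OF FP gen_in_carrier]] genQ])
  qed
  fix B' assume "B' \<in> free_obs V"
  then obtain B where B: "B \<in> free_obs V" and "\<Phi>\<^sub>o B = B'" by (rule ob_surj)
  then have B': "B' = \<Phi>\<^sub>o B" by simp
  have B'_var: "in_variety V B'" unfolding B' by (rule free_obs_in_variety[OF ob_closed[OF B]])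
  show "\<exists>\<mu>\<in>Hom V (\<Phi>\<^sub>o (F P)) B'. \<forall>i\<in>P \<times> Q.
      \<mu> (\<Phi>\<^sub>m (F {0}) (F P) (elt (F P) (gen V P (fst i))) (gen V Q (snd i))) = c i"
    if c: "\<forall>i\<in>P \<times> Q. c i \<in> carrier B'" for c
  proof -
    have "\<exists>b\<in>carrier B. \<forall>q\<in>Q. \<Phi>\<^sub>m (F {0}) B (elt B b) (gen V Q q) = c (p, q)" if p: "p \<in> P" for p
    proof -
      define \<eta> where "\<eta> = lift V Q B' (\<lambda>q. c (p, q))"
      have cp: "c (p, q) \<in> carrier B'" if "q \<in> Q" for q using c p that by blast
      have "\<eta> \<in> Hom V (F Q) B'" unfolding \<eta>_def by (rule lift_Hom[OF B'_var cp])
      then have "\<eta> \<in> Hom V (\<Phi>\<^sub>o (F {0})) (\<Phi>\<^sub>o B)" by (simp add: B' Q(2))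
      then obtain \<theta> where \<theta>: "\<theta> \<in> Hom V (F {0}) B" "\<Phi>\<^sub>m (F {0}) B \<theta> = \<eta>"
        by (rule mor_surj[OF F1 B])
      have "\<eta> (gen V Q q) = c (p, q)" if "q \<in> Q" for q
        unfolding \<eta>_def by (rule lift_gen[OF B'_var cp that])
      then show ?thesis
        using elt_eta[OF B \<theta>(1)] \<theta>(2) Hom_closed[OF \<theta>(1) gen_in_carrier[of 0 "{0}"]]
        by (intro bexI[of _ "\<theta> (gen V {0} 0)"]) auto
    qed
    then obtain b where b: "\<And>p. p \<in> P \<Longrightarrow> b p \<in> carrier B"
      "\<And>p q. p \<in> P \<Longrightarrow> q \<in> Q \<Longrightarrow> \<Phi>\<^sub>m (F {0}) B (elt B (b p)) (gen V Q q) = c (p, q)"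
      by metis
    define \<mu> where "\<mu> = lift V P B b"
    have \<mu>: "\<mu> \<in> Hom V (F P) B" unfolding \<mu>_def by (rule lift_Hom[OF free_obs_in_variety[OF B] b(1)])
    have \<mu>_gen: "\<mu> (gen V P p) = b p" if "p \<in> P" for p
      unfolding \<mu>_def by (rule lift_gen[OF free_obs_in_variety[OF B] b(1) that])
    show ?thesis
    proof (intro bexI[of _ "\<Phi>\<^sub>m (F P) B \<mu>"] ballI)
      fix i assume i: "i \<in> P \<times> Q"
      then have "fst i \<in> P" "snd i \<in> Q" by auto
      then show "\<Phi>\<^sub>m (F P) B \<mu> (\<Phi>\<^sub>m (F {0}) (F P) (elt (F P) (gen V P (fst i))) (gen V Q (snd i))) = c i"
        by (simp add: image_gen[OF B \<mu>] \<mu>_gen b(2))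
    qed (use mor_closed[OF FP B \<mu>] B' in simp)
  qed
  show "\<mu>' = \<nu>'"
    if \<mu>': "\<mu>' \<in> Hom V (\<Phi>\<^sub>o (F P)) B'" and \<nu>': "\<nu>' \<in> Hom V (\<Phi>\<^sub>o (F P)) B'"
      and eq: "\<forall>i\<in>P \<times> Q. \<mu>' (\<Phi>\<^sub>m (F {0}) (F P) (elt (F P) (gen V P (fst i))) (gen V Q (snd i))) =
        \<nu>' (\<Phi>\<^sub>m (F {0}) (F P) (elt (F P) (gen V P (fst i))) (gen V Q (snd i)))" for \<mu>' \<nu>'
  proof -
    obtain \<mu> where \<mu>: "\<mu> \<in> Hom V (F P) B" "\<Phi>\<^sub>m (F P) B \<mu> = \<mu>'" by (rule mor_surj[OF FP B \<mu>'[unfolded B']])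
    obtain \<nu> where \<nu>: "\<nu> \<in> Hom V (F P) B" "\<Phi>\<^sub>m (F P) B \<nu> = \<nu>'" by (rule mor_surj[OF FP B \<nu>'[unfolded B']])
    have "\<mu> (gen V P p) = \<nu> (gen V P p)" if p: "p \<in> P" for p
    proof -
      have closed: "\<mu> (gen V P p) \<in> carrier B" "\<nu> (gen V P p) \<in> carrier B"
        using Hom_closed[OF \<mu>(1) gen_in_carrier[OF p]] Hom_closed[OF \<nu>(1) gen_in_carrier[OF p]] .
      have Hom: "\<Phi>\<^sub>m (F {0}) B (elt B b) \<in> Hom V (F Q) (\<Phi>\<^sub>o B)" if "b \<in> carrier B" for b
        using mor_closed[OF F1 B elt_Hom[OF B that]] Q(2) by simp
      have "\<Phi>\<^sub>m (F {0}) B (elt B (\<mu> (gen V P p))) = \<Phi>\<^sub>m (F {0}) B (elt B (\<nu> (gen V P p)))"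
      proof (rule Hom_free_eqI[OF Hom[OF closed(1)] Hom[OF closed(2)]])
        fix q assume q: "q \<in> Q"
        show "\<Phi>\<^sub>m (F {0}) B (elt B (\<mu> (gen V P p))) (gen V Q q) = \<Phi>\<^sub>m (F {0}) B (elt B (\<nu> (gen V P p))) (gen V Q q)"
          using bspec[OF eq, of "(p, q)"] p q image_gen[OF B \<mu>(1) p q] image_gen[OF B \<nu>(1) p q] \<mu>(2) \<nu>(2) by simp
      qed
      then have "elt B (\<mu> (gen V P p)) = elt B (\<nu> (gen V P p))"
        by (rule mor_inject[OF F1 B elt_Hom[OF B closed(1)] elt_Hom[OF B closed(2)]])
      then show ?thesis by (rule elt_inject[OF B closed])
    qed
    then have "\<mu> = \<nu>" by (rule Hom_free_eqI[OF \<mu>(1) \<nu>(1)])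
    then show ?thesis using \<mu>(2) \<nu>(2) by simp
  qed
qed

text \<open>
  If \<open>\<Phi>\<^sub>o\<close> sends \<open>F {0}\<close> to \<open>F Q\<close> and \<open>F P\<close> to \<open>F {0}\<close>, then \<open>F {0}\<close> has a basis of \<open>card P * card Q\<close>
  elements, so invariance of rank forces both cardinalities to be one.
\<close>

lemma monogenic_image:
  assumes ibn: "IBN_variety V"
  obtains q where "\<Phi>\<^sub>o (F {0}) = F {q}"
proof -
  obtain Q where Q: "finite Q" "\<Phi>\<^sub>o (F {0}) = F Q"
    using ob_closed[OF free_obsI[of "{0}"]] by (auto elim: free_obsE)
  obtain A where A: "A \<in> free_obs V" "\<Phi>\<^sub>o A = F {0}" using ob_surj[OF free_obsI[of "{0}"]] by auto
  obtain P where P: "finite P" "A = F P" using A(1) by (rule free_obsE)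
  have "card (P \<times> Q) = card {0::nat}"
    using free_basis_card[OF ibn free_basis_image[OF P(1) Q, unfolded A(2)[unfolded P(2)]]] P(1) Q(1) by simp
  then have "card Q = 1" by (simp add: card_cartesian_product)
  then show ?thesis using Q(2) that by (auto simp: card_1_singleton_iff)
qed

end

locale free_automorphism_monogenic = free_automorphism V \<Phi>\<^sub>o \<Phi>\<^sub>m
  for V :: "'f variety" and \<Phi>\<^sub>o :: "'f ob_map" and \<Phi>\<^sub>m :: "'f mor_map" +
  fixes q assumes monogenic: "\<Phi>\<^sub>o (F {0}) = F {q}"
begin

text \<open>
  On elements the automorphism is a natural family of bijections: it sends the element named by
  \<^term>\<open>elt A a\<close> to the one named by the image of that morphism, once a generator of
  \<^term>\<open>\<Phi>\<^sub>o (F {0})\<close> is chosen.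
\<close>

definition S :: "('f, 'f trm set) algebra \<Rightarrow> 'f trm set \<Rightarrow> 'f trm set" where
  "S A a = \<Phi>\<^sub>m (F {0}) A (elt A a) (gen V {q} q)"

lemma F1: "F {0} \<in> free_obs V"
  by (simp add: free_obsI)

lemma gen_q: "gen V {q} q \<in> carrier (\<Phi>\<^sub>o (F {0}))"
  by (simp add: monogenic gen_in_carrier)

lemma mor_elt_Hom: "A \<in> free_obs V \<Longrightarrow> a \<in> carrier A \<Longrightarrow> \<Phi>\<^sub>m (F {0}) A (elt A a) \<in> Hom V (F {q}) (\<Phi>\<^sub>o A)"
  using mor_closed[OF F1 _ elt_Hom] by (simp add: monogenic)

lemma S_natural:
  assumes "A \<in> free_obs V" "B \<in> free_obs V" "\<mu> \<in> Hom V A B" "a \<in> carrier A"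
  shows "\<Phi>\<^sub>m A B \<mu> (S A a) = S B (\<mu> a)"
  unfolding S_def by (rule mor_elt[OF assms gen_q])

lemma S_bij:
  assumes A: "A \<in> free_obs V"
  shows "bij_betw (S A) (carrier A) (carrier (\<Phi>\<^sub>o A))"
proof (rule bij_betw_imageI)
  show "inj_on (S A) (carrier A)"
  proof (rule inj_onI)
    fix a b assume a: "a \<in> carrier A" and b: "b \<in> carrier A" and eq: "S A a = S A b"
    have "\<Phi>\<^sub>m (F {0}) A (elt A a) = \<Phi>\<^sub>m (F {0}) A (elt A b)"
      using eq by (intro Hom_free_eqI[OF mor_elt_Hom[OF A a] mor_elt_Hom[OF A b]]) (simp add: S_def)
    then have "elt A a = elt A b" by (rule mor_inject[OF F1 A elt_Hom[OF A a] elt_Hom[OF A b]])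
    then show "a = b" by (rule elt_inject[OF A a b])
  qed
  show "S A ` carrier A = carrier (\<Phi>\<^sub>o A)"
  proof (intro equalityI subsetI)
    fix d assume "d \<in> S A ` carrier A"
    then show "d \<in> carrier (\<Phi>\<^sub>o A)"
      using Hom_closed[OF mor_closed[OF F1 A elt_Hom[OF A]] gen_q] by (auto simp: S_def)
  next
    fix d assume d: "d \<in> carrier (\<Phi>\<^sub>o A)"
    note var = free_obs_in_variety[OF ob_closed[OF A]]
    have "lift V {q} (\<Phi>\<^sub>o A) (\<lambda>_. d) \<in> Hom V (\<Phi>\<^sub>o (F {0})) (\<Phi>\<^sub>o A)"
      unfolding monogenic by (rule lift_Hom[OF var d])
    then obtain \<theta> where \<theta>: "\<theta> \<in> Hom V (F {0}) A" "\<Phi>\<^sub>m (F {0}) A \<theta> = lift V {q} (\<Phi>\<^sub>o A) (\<lambda>_. d)"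
      by (rule mor_surj[OF F1 A])
    have "S A (\<theta> (gen V {0} 0)) = d"
      using lift_gen[OF var d, of q "{q}"] by (simp add: S_def elt_eta[OF A \<theta>(1)] \<theta>(2))
    then show "d \<in> S A ` carrier A" using Hom_closed[OF \<theta>(1) gen_in_carrier[of 0 "{0}"]] by blast
  qed
qed

lemma S_closed: "A \<in> free_obs V \<Longrightarrow> a \<in> carrier A \<Longrightarrow> S A a \<in> carrier (\<Phi>\<^sub>o A)"
  using S_bij bij_betwE by metis

text \<open>
  The images of the generators form a basis, so besides the bijection \<^term>\<open>S (F X)\<close>, which need not
  be a homomorphism, there is an isomorphism that agrees with it on the generators.
\<close>

definition s :: "nat set \<Rightarrow> 'f trm set \<Rightarrow> 'f trm set" where
  "s X = lift V X (\<Phi>\<^sub>o (F X)) (\<lambda>x. S (F X) (gen V X x))"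

lemma s_Iso: assumes "finite X" shows "s X \<in> Iso V (F X) (\<Phi>\<^sub>o (F X))"
proof -
  have "bij_betw (\<lambda>x. (x, q)) X (X \<times> {q})" by (auto simp: bij_betw_def inj_on_def)
  then have "free_basis X (\<lambda>x. S (F X) (gen V X x)) (\<Phi>\<^sub>o (F X))"
    using free_basis_reindex[OF free_basis_image[OF assms _ monogenic], of "\<lambda>x. (x, q)" X] by (simp add: S_def)
  then show ?thesis unfolding s_def using assms by (rule free_basis_Iso)
qed

lemma s_gen: assumes "finite X" "x \<in> X" shows "s X (gen V X x) = S (F X) (gen V X x)"
  unfolding s_def
  by (rule lift_gen[OF free_obs_in_variety[OF ob_closed[OF free_obsI[OF assms(1)]]] _ assms(2)])
    (rule S_closed[OF free_obsI[OF assms(1)] gen_in_carrier])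

text \<open>The failure of \<^term>\<open>S (F X)\<close> to be a homomorphism, as a permutation of \<open>F X\<close> that fixes the generators.\<close>

definition \<sigma> :: "nat set \<Rightarrow> 'f trm set \<Rightarrow> 'f trm set" where
  "\<sigma> X = compose (carrier (F X)) (restrict (inv_into (carrier (F X)) (s X)) (carrier (\<Phi>\<^sub>o (F X)))) (S (F X))"

context
  fixes X :: "nat set" assumes X: "finite X"
begin

lemma s_Hom: "s X \<in> Hom V (F X) (\<Phi>\<^sub>o (F X))" and s_bij: "bij_betw (s X) (carrier (F X)) (carrier (\<Phi>\<^sub>o (F X)))"
  using s_Iso[OF X] by (auto simp: Iso_def)

lemma \<sigma>_eq: "a \<in> carrier (F X) \<Longrightarrow> \<sigma> X a = inv_into (carrier (F X)) (s X) (S (F X) a)"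
  using S_closed[OF free_obsI[OF X]] by (simp add: \<sigma>_def compose_eq)

lemma s_\<sigma>: "a \<in> carrier (F X) \<Longrightarrow> s X (\<sigma> X a) = S (F X) a"
  using \<sigma>_eq bij_betw_inv_into_right[OF s_bij] S_closed[OF free_obsI[OF X]] by metis

lemma \<sigma>_gen: "x \<in> X \<Longrightarrow> \<sigma> X (gen V X x) = gen V X x"
  using \<sigma>_eq[OF gen_in_carrier] s_gen[OF X] bij_betw_inv_into_left[OF s_bij] gen_in_carrier by metis

lemma \<sigma>_bij: "bij_betw (\<sigma> X) (carrier (F X)) (carrier (F X))"
proof -
  have "bij_betw (inv_into (carrier (F X)) (s X) \<circ> S (F X)) (carrier (F X)) (carrier (F X))"
    by (rule bij_betw_trans[OF S_bij[OF free_obsI[OF X]] bij_betw_inv_into[OF s_bij]])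
  then show ?thesis by (rule bij_betw_cong[THEN iffD1, rotated]) (simp add: \<sigma>_eq)
qed

lemma \<sigma>_closed: "a \<in> carrier (F X) \<Longrightarrow> \<sigma> X a \<in> carrier (F X)"
  using \<sigma>_bij bij_betwE by metis

end

text \<open>Conjugating by \<open>s\<close> turns the automorphism into one that acts on elements by \<open>\<sigma>\<close>.\<close>

lemma \<sigma>_natural:
  assumes X: "finite X" and Y: "finite Y" and \<mu>: "\<mu> \<in> Hom V (F X) (F Y)"
  obtains \<psi> where "\<psi> \<in> Hom V (F X) (F Y)" "\<And>a. a \<in> carrier (F X) \<Longrightarrow> \<psi> (\<sigma> X a) = \<sigma> Y (\<mu> a)"
proof -
  note obs = free_obsI[OF X] free_obsI[OF Y]
  define r where "r = restrict (inv_into (carrier (F Y)) (s Y)) (carrier (\<Phi>\<^sub>o (F Y)))"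
  define \<psi> where "\<psi> = compose (carrier (F X)) (compose (carrier (\<Phi>\<^sub>o (F X))) r (\<Phi>\<^sub>m (F X) (F Y) \<mu>)) (s X)"
  have r: "r \<in> Hom V (\<Phi>\<^sub>o (F Y)) (F Y)" unfolding r_def by (rule Iso_inverse[OF free_algebra s_Iso[OF Y]])
  have "\<psi> \<in> Hom V (F X) (F Y)"
    unfolding \<psi>_def
    by (rule Hom_compose[OF free_algebra s_Hom[OF X] Hom_compose[OF free_obs_algebra[OF ob_closed[OF obs(1)]] mor_closed[OF obs \<mu>] r]])
  moreover have "\<psi> (\<sigma> X a) = \<sigma> Y (\<mu> a)" if a: "a \<in> carrier (F X)" for a
    using \<sigma>_closed[OF X a] S_closed[OF obs(1) a] S_closed[OF obs(2) Hom_closed[OF \<mu> a]]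
    by (simp add: \<psi>_def r_def compose_eq s_\<sigma>[OF X a] S_natural[OF obs \<mu> a] \<sigma>_eq[OF Y Hom_closed[OF \<mu> a]])
  ultimately show ?thesis by (rule that)
qed

text \<open>
  The only possible choice: if \<open>\<sigma>\<close> fixes the generators and carries \<open>f\<close> to the operation given by a word,
  then applying it to the value of \<open>f\<close> at the generators returns that word.
\<close>

definition word :: "'f \<Rightarrow> 'f trm set" where
  "word f = \<sigma> {..<arity V f} (interp (F {..<arity V f}) f (map (gen V {..<arity V f}) [0..<arity V f]))"

lemma generic_value_in_carrier:
  assumes "f \<in> symbols V"
  shows "interp (F {..<arity V f}) f (map (gen V {..<arity V f}) [0..<arity V f]) \<in> carrier (F {..<arity V f})"
proof -
  have "set (map (gen V {..<arity V f}) [0..<arity V f]) \<subseteq> carrier (F {..<arity V f})"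
    by (auto intro!: gen_in_carrier)
  then show ?thesis using free_algebra[unfolded is_algebra_def] assms by (metis length_map length_upt diff_zero)
qed

lemma Op1_word: "Op1 V word"
  unfolding Op1_def word_def using \<sigma>_closed[OF _ generic_value_in_carrier] by simp

text \<open>
  The operation \<open>f\<close> at \<open>as\<close> is the image of its value at the generators under the homomorphism \<open>\<mu>\<close> that sends
  the generators to \<open>as\<close>. By naturality \<open>\<sigma>\<close> turns \<open>\<mu>\<close> into the homomorphism that sends the generators
  to \<^term>\<open>map (\<sigma> X) as\<close>, which evaluates the word for \<open>f\<close> there.
\<close>

lemma \<sigma>_Iso_star:
  assumes X: "finite X"
  shows "\<sigma> X \<in> Iso V (F X) (star V word (F X))"
proof -
  have "\<sigma> X (interp (F X) f as) = verbal_op V (F X) (arity V f) (word f) (map (\<sigma> X) as)"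
    if f: "f \<in> symbols V" and len: "length as = arity V f" and as: "set as \<subseteq> carrier (F X)" for f as
  proof -
    define Y where "Y = {..<arity V f}"
    define u where "u = interp (F Y) f (map (gen V Y) [0..<arity V f])"
    have Y: "finite Y" by (simp add: Y_def)
    have u: "u \<in> carrier (F Y)" unfolding u_def Y_def by (rule generic_value_in_carrier[OF f])
    have nth: "as ! i \<in> carrier (F X)" if "i \<in> Y" for i using as len that by (auto simp: Y_def)
    define \<mu> where "\<mu> = lift V Y (F X) (nth as)"
    have \<mu>: "\<mu> \<in> Hom V (F Y) (F X)" unfolding \<mu>_def by (rule lift_Hom[OF free_in_variety]) (rule nth)
    have \<mu>_gen: "\<mu> (gen V Y i) = as ! i" if "i \<in> Y" for i
      unfolding \<mu>_def by (rule lift_gen[OF free_in_variety _ that]) (rule nth)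
    have gens: "set (map (gen V Y) [0..<arity V f]) \<subseteq> carrier (F Y)"
      by (auto intro!: gen_in_carrier simp: Y_def)
    have "map \<mu> (map (gen V Y) [0..<arity V f]) = as"
      using len \<mu>_gen by (intro nth_equalityI) (auto simp: Y_def)
    then have \<mu>u: "\<mu> u = interp (F X) f as"
      unfolding u_def using Hom_interp[OF \<mu> f _ gens] by simp
    obtain \<psi> where \<psi>: "\<psi> \<in> Hom V (F Y) (F X)" "\<And>a. a \<in> carrier (F Y) \<Longrightarrow> \<psi> (\<sigma> Y a) = \<sigma> X (\<mu> a)"
      using \<sigma>_natural[OF Y X \<mu>] by metis
    have "lift V Y (F X) (nth (map (\<sigma> X) as)) = \<psi>"
    proof (rule lift_eqI[OF free_in_variety \<psi>(1)])
      fix i assume i: "i \<in> Y"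
      have "\<psi> (gen V Y i) = \<sigma> X (as ! i)"
        using \<psi>(2)[OF gen_in_carrier[OF i]] \<sigma>_gen[OF Y i] \<mu>_gen[OF i] by simp
      then show "\<psi> (gen V Y i) = map (\<sigma> X) as ! i" using i len by (simp add: Y_def)
    qed
    then have "verbal_op V (F X) (arity V f) (\<sigma> Y u) (map (\<sigma> X) as) = \<psi> (\<sigma> Y u)"
      unfolding verbal_op_lift Y_def[symmetric] by simp
    then show ?thesis using \<psi>(2)[OF u] \<mu>u by (simp add: word_def u_def Y_def)
  qed
  moreover have "\<sigma> X \<in> carrier (F X) \<rightarrow>\<^sub>E carrier (F X)"
    using \<sigma>_closed[OF X] by (auto simp: \<sigma>_def compose_def)
  ultimately show ?thesis using \<sigma>_bij[OF X] by (simp add: Iso_def Hom_def star_def)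
qed

lemma Op2_word: "Op2 V word"
  unfolding Op2_def by (intro allI impI bexI[OF _ \<sigma>_Iso_star] ballI \<sigma>_gen)

text \<open>
  Homomorphisms to the derived algebra factor through \<open>\<sigma>\<close>, and ordinary ones through the isomorphism
  \<open>s\<close>; together they factor through \<open>s \<circ> \<sigma> = S\<close>.
\<close>

lemma Hom_star_S:
  fixes H :: "('f, 'c) algebra"
  assumes H: "in_variety V H" and X: "finite X"
  shows "Hom V (F X) (star V word H) = (\<lambda>\<nu>. compose (carrier (F X)) \<nu> (S (F X))) ` Hom V (\<Phi>\<^sub>o (F X)) H"
proof -
  have "Hom V (F X) H = (\<lambda>\<nu>. compose (carrier (F X)) \<nu> (s X)) ` Hom V (\<Phi>\<^sub>o (F X)) H"
  proof (intro equalityI subsetI)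
    fix \<nu> assume \<nu>: "\<nu> \<in> Hom V (F X) H"
    define r where "r = restrict (inv_into (carrier (F X)) (s X)) (carrier (\<Phi>\<^sub>o (F X)))"
    define \<nu>' where "\<nu>' = compose (carrier (\<Phi>\<^sub>o (F X))) \<nu> r"
    have \<nu>': "\<nu>' \<in> Hom V (\<Phi>\<^sub>o (F X)) H"
      unfolding \<nu>'_def r_def
      by (rule Hom_compose[OF free_obs_algebra[OF ob_closed[OF free_obsI[OF X]]] Iso_inverse[OF free_algebra s_Iso[OF X]] \<nu>])
    have "\<nu> = compose (carrier (F X)) \<nu>' (s X)"
    proof (rule extensionalityI[OF Hom_extensional[OF \<nu>] compose_extensional])
      fix a assume a: "a \<in> carrier (F X)"
      have sa: "s X a \<in> carrier (\<Phi>\<^sub>o (F X))" by (rule Hom_closed[OF s_Hom[OF X] a])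
      have "r (s X a) = a"
        unfolding r_def restrict_apply'[OF sa] by (rule bij_betw_inv_into_left[OF s_bij[OF X] a])
      then show "\<nu> a = compose (carrier (F X)) \<nu>' (s X) a"
        unfolding \<nu>'_def compose_eq[OF a] compose_eq[OF sa] by simp
    qed
    then show "\<nu> \<in> (\<lambda>\<nu>. compose (carrier (F X)) \<nu> (s X)) ` Hom V (\<Phi>\<^sub>o (F X)) H"
      using \<nu>' by (rule image_eqI)
  next
    fix \<nu> assume "\<nu> \<in> (\<lambda>\<nu>. compose (carrier (F X)) \<nu> (s X)) ` Hom V (\<Phi>\<^sub>o (F X)) H"
    then obtain \<nu>' where "\<nu>' \<in> Hom V (\<Phi>\<^sub>o (F X)) H" "\<nu> = compose (carrier (F X)) \<nu>' (s X)" by (rule imageE)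
    then show "\<nu> \<in> Hom V (F X) H" using Hom_compose[OF free_algebra s_Hom[OF X], of \<nu>'] by (simp only:)
  qed
  moreover have "compose (carrier (F X)) (compose (carrier (F X)) \<nu> (s X)) (\<sigma> X) = compose (carrier (F X)) \<nu> (S (F X))" for \<nu> :: "'f trm set \<Rightarrow> 'c"
    by (rule extensionalityI[OF compose_extensional compose_extensional])
      (simp add: compose_eq \<sigma>_closed[OF X] s_\<sigma>[OF X])
  moreover have "Hom V (F X) (star V word H) = (\<lambda>\<nu>. compose (carrier (F X)) \<nu> (\<sigma> X)) ` Hom V (F X) H"
    by (rule Hom_to_star[OF Op1_word H \<sigma>_Iso_star[OF X]]) (rule \<sigma>_gen[OF X])
  ultimately show ?thesis by (simp only: image_image)
qed

end

section \<open>Automorphic equivalence\<close>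

text \<open>
  Since the compatibility condition forces \<open>\<alpha>\<close> to be \<open>S \<times> S\<close>, and homomorphisms to the derived algebra
  factor through \<open>S\<close>, the relations closed for \<open>H\<^sub>1\<close> and for the derived algebra of \<open>H\<^sub>2\<close> are both those whose
  image under \<open>S \<times> S\<close> is closed for \<open>H\<^sub>2\<close>.
\<close>

lemma (in equational_class) words_if_automorphically_equivalent:
  assumes ibn: "IBN_variety V" and H2: "in_variety V H\<^sub>2" and ae: "automorphically_equivalent V H\<^sub>1 H\<^sub>2"
  shows "\<exists>w. Op1 V w \<and> Op2 V w \<and> geometrically_equivalent V H\<^sub>1 (star V w H\<^sub>2)"
proof -
  obtain \<Phi>\<^sub>o \<Phi>\<^sub>m \<alpha> where aut: "category_automorphism V \<Phi>\<^sub>o \<Phi>\<^sub>m"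
    and \<alpha>_all: "\<forall>B\<in>free_obs V. bij_betw (\<alpha> B) (Cl V H\<^sub>1 B) (Cl V H\<^sub>2 (\<Phi>\<^sub>o B))"
    and compat_all: "\<forall>A\<in>free_obs V. \<forall>B\<in>free_obs V. \<forall>\<mu>\<in>Hom V A B. \<forall>\<nu>\<in>Hom V A B. \<forall>T\<in>Cl V H\<^sub>1 B.
      compose (carrier A) (nat_epi B T) \<mu> = compose (carrier A) (nat_epi B T) \<nu> \<longleftrightarrow>
      compose (carrier (\<Phi>\<^sub>o A)) (nat_epi (\<Phi>\<^sub>o B) (\<alpha> B T)) (\<Phi>\<^sub>m A B \<mu>) =
      compose (carrier (\<Phi>\<^sub>o A)) (nat_epi (\<Phi>\<^sub>o B) (\<alpha> B T)) (\<Phi>\<^sub>m A B \<nu>)"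
    using ae unfolding automorphically_equivalent_def by (elim exE conjE) (rule that)
  note \<alpha> = bspec[OF \<alpha>_all]
  note compat = bspec[OF bspec[OF bspec[OF bspec[OF bspec[OF compat_all]]]]]
  interpret free_automorphism V \<Phi>\<^sub>o \<Phi>\<^sub>m by unfold_locales (rule aut)
  obtain q where q: "\<Phi>\<^sub>o (F {0}) = F {q}" using monogenic_image[OF ibn] .
  interpret free_automorphism_monogenic V \<Phi>\<^sub>o \<Phi>\<^sub>m q by unfold_locales (rule q)
  have \<alpha>_Cl: "\<alpha> A T \<in> Cl V H\<^sub>2 (\<Phi>\<^sub>o A)" if "A \<in> free_obs V" "T \<in> Cl V H\<^sub>1 A" for A T
    using bij_betwE[OF \<alpha>[OF that(1)]] that(2) by blast
  \<comment> \<open>The compatibility condition for morphisms out of the monogenic algebra pins \<open>\<alpha>\<close> down.\<close>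
  have S_mem: "(a, b) \<in> T \<longleftrightarrow> (S A a, S A b) \<in> \<alpha> A T"
    if A: "A \<in> free_obs V" and T: "T \<in> Cl V H\<^sub>1 A" and a: "a \<in> carrier A" and b: "b \<in> carrier A" for A T a b
  proof -
    note Homs = elt_Hom[OF A a] elt_Hom[OF A b]
    note \<Phi>Homs = mor_closed[OF F1 A Homs(1)] mor_closed[OF F1 A Homs(2)]
    have "(a, b) \<in> T \<longleftrightarrow> (\<forall>c\<in>carrier (F {0}). (elt A a c, elt A b c) \<in> T)"
    proof (intro iffI ballI)
      fix c assume "(a, b) \<in> T" and c: "c \<in> carrier (F {0})"
      then show "(elt A a c, elt A b c) \<in> T"
        by (intro Cl_agree_on_gens[OF T Homs _ c]) (simp add: elt_gen[OF A a] elt_gen[OF A b])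
    next
      assume "\<forall>c\<in>carrier (F {0}). (elt A a c, elt A b c) \<in> T"
      from bspec[OF this gen_in_carrier[of 0]] show "(a, b) \<in> T" by (simp add: elt_gen[OF A a] elt_gen[OF A b])
    qed
    also have "\<dots> \<longleftrightarrow> (\<forall>c\<in>carrier (\<Phi>\<^sub>o (F {0})). (\<Phi>\<^sub>m (F {0}) A (elt A a) c, \<Phi>\<^sub>m (F {0}) A (elt A b) c) \<in> \<alpha> A T)"
      using compat[OF F1 A Homs T]
      unfolding compose_nat_epi_eq_iff[OF T Homs] compose_nat_epi_eq_iff[OF \<alpha>_Cl[OF A T] \<Phi>Homs] .
    also have "\<dots> \<longleftrightarrow> (S A a, S A b) \<in> \<alpha> A T"
    proof (intro iffI ballI)
      fix c assume S: "(S A a, S A b) \<in> \<alpha> A T" and c: "c \<in> carrier (\<Phi>\<^sub>o (F {0}))"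
      show "(\<Phi>\<^sub>m (F {0}) A (elt A a) c, \<Phi>\<^sub>m (F {0}) A (elt A b) c) \<in> \<alpha> A T"
        by (rule Cl_agree_on_gens[OF \<alpha>_Cl[OF A T] \<Phi>Homs[unfolded q] _ c[unfolded q]]) (use S in \<open>simp add: S_def\<close>)
    next
      assume "\<forall>c\<in>carrier (\<Phi>\<^sub>o (F {0})). (\<Phi>\<^sub>m (F {0}) A (elt A a) c, \<Phi>\<^sub>m (F {0}) A (elt A b) c) \<in> \<alpha> A T"
      from bspec[OF this gen_q] show "(S A a, S A b) \<in> \<alpha> A T" by (simp add: S_def)
    qed
    finally show ?thesis .
  qed
  have \<alpha>_eq: "\<alpha> A T = map_prod (S A) (S A) ` T" if A: "A \<in> free_obs V" and T: "T \<in> Cl V H\<^sub>1 A" for A T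
  proof (intro equalityI subrelI)
    fix c d assume cd: "(c, d) \<in> \<alpha> A T"
    then have "(c, d) \<in> carrier (\<Phi>\<^sub>o A) \<times> carrier (\<Phi>\<^sub>o A)" by (rule subsetD[OF Cl_subset[OF \<alpha>_Cl[OF A T]]])
    then have "c \<in> S A ` carrier A" "d \<in> S A ` carrier A"
      by (simp_all add: bij_betw_imp_surj_on[OF S_bij[OF A]])
    then obtain a b where a: "a \<in> carrier A" "c = S A a" and b: "b \<in> carrier A" "d = S A b" by (elim imageE)
    have "(a, b) \<in> T" using S_mem[OF A T a(1) b(1)] cd a(2) b(2) by simp
    then show "(c, d) \<in> map_prod (S A) (S A) ` T" using a(2) b(2) by (intro image_eqI[of _ _ "(a, b)"]) simp_all
  next
    fix c d assume "(c, d) \<in> map_prod (S A) (S A) ` T"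
    then obtain a b where ab: "(a, b) \<in> T" "c = S A a" "d = S A b" by auto
    have "(a, b) \<in> carrier A \<times> carrier A" using ab(1) by (rule subsetD[OF Cl_subset[OF T]])
    then show "(c, d) \<in> \<alpha> A T" using S_mem[OF A T, of a b] ab by simp
  qed
  have Cl_S: "T \<in> Cl V H\<^sub>1 A \<longleftrightarrow> map_prod (S A) (S A) ` T \<in> Cl V H\<^sub>2 (\<Phi>\<^sub>o A)"
    if A: "A \<in> free_obs V" and T: "T \<subseteq> carrier A \<times> carrier A" for A T
  proof
    assume "T \<in> Cl V H\<^sub>1 A"
    then show "map_prod (S A) (S A) ` T \<in> Cl V H\<^sub>2 (\<Phi>\<^sub>o A)" using \<alpha>_eq[OF A] \<alpha>_Cl[OF A, of T] by simp
  next
    assume "map_prod (S A) (S A) ` T \<in> Cl V H\<^sub>2 (\<Phi>\<^sub>o A)"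
    then have "map_prod (S A) (S A) ` T \<in> \<alpha> A ` Cl V H\<^sub>1 A"
      by (simp only: bij_betw_imp_surj_on[OF \<alpha>[OF A]])
    then obtain T' where T': "T' \<in> Cl V H\<^sub>1 A" "map_prod (S A) (S A) ` T = \<alpha> A T'" by (elim imageE)
    have "map_prod (S A) (S A) ` T = map_prod (S A) (S A) ` T'" unfolding T'(2) by (rule \<alpha>_eq[OF A T'(1)])
    then have "T = T'"
      by (rule map_prod_image_inject[OF bij_betw_imp_inj_on[OF S_bij[OF A]] T Cl_subset[OF T'(1)]])
    then show "T \<in> Cl V H\<^sub>1 A" using T'(1) by simp
  qed
  have "geometrically_equivalent V H\<^sub>1 (star V word H\<^sub>2)"
    unfolding geometrically_equivalent_def
  proof (intro ballI set_eqI)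
    fix A T assume A: "A \<in> free_obs V"
    then obtain X where X: "finite X" "A = F X" by (rule free_obsE)
    show "T \<in> Cl V H\<^sub>1 A \<longleftrightarrow> T \<in> Cl V (star V word H\<^sub>2) A"
    proof (cases "T \<subseteq> carrier A \<times> carrier A")
      case True
      show ?thesis
        unfolding Cl_S[OF A True] Cl_transport[OF S_bij[OF A] Hom_star_S[OF H2 X(1), folded X(2)] True] ..
    next
      case False
      then show ?thesis by (simp add: Cl_iff)
    qed
  qed
  then show ?thesis using Op1_word Op2_word by (intro exI[of _ word] conjI)
qed

theorem theorem5p1:
  fixes \<Theta> :: "'f variety"
    and H\<^sub>1 :: "('f, 'a) algebra"
    and H\<^sub>2 :: "('f, 'b) algebra"
  assumes "IBN_variety \<Theta>"
    and "in_variety \<Theta> H\<^sub>1"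
    and "in_variety \<Theta> H\<^sub>2"
  shows "automorphically_equivalent \<Theta> H\<^sub>1 H\<^sub>2 \<longleftrightarrow>
    (\<exists>w. Op1 \<Theta> w \<and> Op2 \<Theta> w \<and> geometrically_equivalent \<Theta> H\<^sub>1 (star \<Theta> w H\<^sub>2))"
proof -
  interpret equational_class \<Theta> using assms(1) by unfold_locales (simp add: IBN_variety_def)
  show ?thesis
  proof
    assume "automorphically_equivalent \<Theta> H\<^sub>1 H\<^sub>2"
    then show "\<exists>w. Op1 \<Theta> w \<and> Op2 \<Theta> w \<and> geometrically_equivalent \<Theta> H\<^sub>1 (star \<Theta> w H\<^sub>2)"
      by (rule words_if_automorphically_equivalent[OF assms(1,3)])
  next
    assume "\<exists>w. Op1 \<Theta> w \<and> Op2 \<Theta> w \<and> geometrically_equivalent \<Theta> H\<^sub>1 (star \<Theta> w H\<^sub>2)"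
    then show "automorphically_equivalent \<Theta> H\<^sub>1 H\<^sub>2"
      by (elim exE conjE) (rule automorphically_equivalent_if_words[OF _ _ assms(3)])
  qed
qed

end
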